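(* Assume ZFC together with the diamond principle $\diamondsuit_{\aleph_1}$. Let $R$ be a countable principal ideal domain which is not a field. Then there is a reflexive $R$-module $G$ of cardinality $\aleph_1$ such that $G \not\cong R \oplus G$.
   Context: For an $R$-module $D$ let $D^* = \operatorname{Hom}(D,R)$. The evaluation map $\sigma_D : D \to D^{**}$ sends $d$ to the homomorphism $D^* \to R$, $\varphi \mapsto \varphi(d)$. The module $D$ is called reflexive if $\sigma_D$ is an isomorphism. *)

theory Defs
  imports "HOL-Library.Countable_Set" "HOL-Algebra.Ring_Divisibility" "Jordan_Normal_Form.Missing_VectorSpace"
begin

unbundle cardinal_syntax

section \<open>The diamond principle\<close>

text \<open>
  In the definitions below, \<open>r\<close> is meant to be a well-order of limit type, with the points of
  \<open>Field r\<close> playing the role of the ordinals below that type. The set of predecessors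
  \<open>underS r \<delta>\<close> is then the ordinal \<open>\<delta>\<close> itself, regarded as a set of smaller ordinals.
\<close>

text \<open>
  \<open>cofinal\<close> is strict (it asks for elements of the set strictly above each given point), so the
  hypotheses of the second conjunct of \<open>closed_below\<close> force \<open>\<delta>\<close> to be a limit point.
\<close>

definition closed_below :: "'i rel \<Rightarrow> 'i set \<Rightarrow> bool" where
  "closed_below r C \<longleftrightarrow> C \<subseteq> Field r \<and>
     (\<forall>\<delta>\<in>Field r. underS r \<delta> \<noteq> {} \<and> cofinal (C \<inter> underS r \<delta>) (Restr r (underS r \<delta>)) \<longrightarrow> \<delta> \<in> C)"

definition club :: "'i rel \<Rightarrow> 'i set \<Rightarrow> bool" where
  "club r C \<longleftrightarrow> closed_below r C \<and> cofinal C r"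

definition stationary :: "'i rel \<Rightarrow> 'i set \<Rightarrow> bool" where
  "stationary r E \<longleftrightarrow> E \<subseteq> Field r \<and> (\<forall>C. club r C \<longrightarrow> E \<inter> C \<noteq> {})"

definition diamond :: "'i rel \<Rightarrow> bool" where
  "diamond r \<longleftrightarrow>
     (\<exists>S. (\<forall>\<alpha>\<in>Field r. S \<alpha> \<subseteq> underS r \<alpha>) \<and>
          (\<forall>X. X \<subseteq> Field r \<longrightarrow> stationary r {\<alpha> \<in> Field r. X \<inter> underS r \<alpha> = S \<alpha>}))"

text \<open>
  The first uncountable cardinal, as an initial well-order. The type \<open>nat set\<close> has enough elements
  for a copy of it.
\<close>

abbreviation aleph_1 :: "nat set rel" where
  "aleph_1 \<equiv> cardSuc natLeq"

section \<open>Duals and reflexive modules\<close>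

definition ring_as_module :: "('a, 'r) ring_scheme \<Rightarrow> ('a, 'a) module" where
  "ring_as_module R =
     \<lparr>carrier = carrier R, mult = mult R, one = one R, zero = zero R, add = add R, smult = mult R\<rparr>"

text \<open>
  Homomorphisms are taken to be extensional, so that each one is represented by exactly one HOL
  function. The fields \<open>mult\<close> and \<open>one\<close> play no role in a module and get dummy values.
\<close>

definition hom_module ::
  "('a, 'r) ring_scheme \<Rightarrow> ('a, 'b, 'm) module_scheme \<Rightarrow> ('a, 'c, 'n) module_scheme
     \<Rightarrow> ('a, 'b \<Rightarrow> 'c) module" where
  "hom_module R M N =
     \<lparr>carrier = LinearCombinations.module_hom R M N \<inter> extensional (carrier M),
      mult = (\<lambda>f g. \<lambda>x\<in>carrier M. \<zero>\<^bsub>N\<^esub>),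
      one = (\<lambda>x\<in>carrier M. \<zero>\<^bsub>N\<^esub>),
      zero = (\<lambda>x\<in>carrier M. \<zero>\<^bsub>N\<^esub>),
      add = (\<lambda>f g. \<lambda>x\<in>carrier M. f x \<oplus>\<^bsub>N\<^esub> g x),
      smult = (\<lambda>a f. \<lambda>x\<in>carrier M. a \<odot>\<^bsub>N\<^esub> f x)\<rparr>"

definition dual :: "('a, 'r) ring_scheme \<Rightarrow> ('a, 'b, 'm) module_scheme \<Rightarrow> ('a, 'b \<Rightarrow> 'a) module" where
  "dual R D = hom_module R D (ring_as_module R)"

definition evaluation ::
  "('a, 'r) ring_scheme \<Rightarrow> ('a, 'b, 'm) module_scheme \<Rightarrow> 'b \<Rightarrow> ('b \<Rightarrow> 'a) \<Rightarrow> 'a" where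
  "evaluation R D = (\<lambda>d\<in>carrier D. \<lambda>\<phi>\<in>carrier (dual R D). \<phi> d)"

definition module_iso ::
  "('a, 'r) ring_scheme \<Rightarrow> ('a, 'b, 'm) module_scheme \<Rightarrow> ('a, 'c, 'n) module_scheme
     \<Rightarrow> ('b \<Rightarrow> 'c) set" where
  "module_iso R M N =
     {f \<in> LinearCombinations.module_hom R M N. bij_betw f (carrier M) (carrier N)}"

definition isomorphic_modules ::
  "('a, 'r) ring_scheme \<Rightarrow> ('a, 'b, 'm) module_scheme \<Rightarrow> ('a, 'c, 'n) module_scheme \<Rightarrow> bool" where
  "isomorphic_modules R M N \<longleftrightarrow> module_iso R M N \<noteq> {}"

definition reflexive_module :: "('a, 'r) ring_scheme \<Rightarrow> ('a, 'b, 'm) module_scheme \<Rightarrow> bool" where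
  "reflexive_module R D \<longleftrightarrow>
     Module.module R D \<and> evaluation R D \<in> module_iso R D (dual R (dual R D))"

end

theory Submission
  imports Defs "HOL-Library.Product_Order" "HOL-Library.Countable_Set_Type"
begin

text \<open>
  Write \<open>E\<close> for the finitely supported sequences in \<open>R\<^sup>\<omega>\<close> and \<open>S\<close> for the sequences that tend to \<open>0\<close>
  in the \<open>R\<close>-adic topology, in which the nonzero principal ideals are the basic neighbourhoods
  of \<open>0\<close>. One constructs pure submodules \<open>G\<close> and \<open>H\<close> between \<open>E\<close> and \<open>S\<close>, each of which consists of
  exactly those \<open>f \<in> R\<^sup>\<omega>\<close> whose formal scalar product with every element of the other one
  converges \<open>R\<close>-adically to an element of \<open>R\<close>. Since \<open>G/E\<close> is divisible, a functional on \<open>G\<close> is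
  determined by its values on the unit vectors, so \<open>G\<^sup>* = H\<close>; likewise \<open>H\<^sup>* = G\<close>, and \<open>G\<close> is
  reflexive. An endomorphism of \<open>G\<close> is given by a matrix. The construction ensures that each
  endomorphism \<open>\<phi>\<close> satisfies \<open>s \<phi> = r + (finite rank)\<close> with \<open>s \<noteq> 0\<close>, so that an injective one has
  torsion cokernel, whereas \<open>G \<cong> R \<oplus> G\<close> would give an injective one with cokernel \<open>R\<close>.

  Diamond only enters through CH: the \<open>\<aleph>\<^sub>1\<close> matrices are treated one by one in a recursion along
  \<open>\<aleph>\<^sub>1\<close> with countable approximations to \<open>(G, H)\<close>. If \<open>f\<close> is not in the current countable \<open>H\<close>,
  a sum \<open>x = \<Sum> q\<^sub>n v\<^sub>n\<close> with \<open>v\<^sub>n \<in> E\<close> orthogonal to the first \<open>n\<close> elements of \<open>H\<close> can be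
  added to \<open>G\<close> so that the product of \<open>f\<close> and \<open>x\<close> is not in \<open>R\<close>.
\<close>

section \<open>Set-theoretic preliminaries\<close>

lemma Card_order_aleph_1: "Card_order aleph_1"
  by (rule cardSuc_Card_order[OF natLeq_Card_order])

lemma infinite_Field_aleph_1: "\<not> finite (Field aleph_1)"
  using cardSuc_finite[OF natLeq_Card_order] by (simp add: Field_natLeq)

lemma countable_ordLeq_aleph_1: "\<not> countable A \<longleftrightarrow> aleph_1 \<le>o |A|"
proof -
  have "\<not> countable A \<longleftrightarrow> natLeq <o |A|"
    unfolding countable_card_le_natLeq
    by (rule not_ordLeq_iff_ordLess) (rule natLeq_Well_order, rule card_of_Well_order)
  then show ?thesis
    unfolding cardSuc_ordLess_ordLeq[OF natLeq_Card_order card_of_Card_order] .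
qed

lemma countable_ordLess_aleph_1: "countable A \<longleftrightarrow> |A| <o aleph_1"
  unfolding countable_card_le_natLeq
  by (rule cardSuc_ordLeq_ordLess[OF natLeq_Card_order card_of_Card_order, symmetric])

section \<open>The continuum hypothesis from diamond\<close>

text \<open>Fix a copy \<open>range j\<close> of the natural numbers inside aleph_1; it is bounded.
  The image under \<open>j\<close> of a set \<open>X\<close> of numbers is guessed at some
  \<open>\<alpha>\<close> above the bound, where the guess is the whole image. Choosing such an
  \<open>\<alpha>\<close> for each \<open>X\<close> gives an injection into
  \<open>Field aleph_1\<close>.\<close>

lemma diamond_imp_CH:
  assumes "diamond aleph_1"
  shows "|UNIV :: nat set set| \<le>o aleph_1"
proof -
  let ?r = "aleph_1"
  have r: "Card_order ?r" "\<not> finite (Field ?r)"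
    by (rule Card_order_aleph_1, rule infinite_Field_aleph_1)
  interpret r: wo_rel ?r using r(1) by (simp add: wo_rel_def card_order_on_def)
  obtain S where S: "\<And>X. X \<subseteq> Field ?r \<Longrightarrow>
      stationary ?r {\<alpha> \<in> Field ?r. X \<inter> underS ?r \<alpha> = S \<alpha>}"
    using assms unfolding diamond_def by blast
  obtain j :: "nat \<Rightarrow> nat set" where j: "inj j" "range j \<subseteq> Field ?r"
    using r(2) infinite_countable_subset by blast
  \<comment> \<open>By regularity a cofinal subset of aleph_1 has cardinality aleph_1, which a
    countable set does not have.\<close>
  have "\<not> cofinal (range j) ?r"
  proof
    assume "cofinal (range j) ?r"
    then have "|range j| =o ?r"
      using infinite_cardSuc_regularCard[OF _ natLeq_Card_order] j(2)
      unfolding regularCard_def by (simp add: Field_natLeq)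
    moreover have "|range j| <o ?r"
      unfolding countable_ordLess_aleph_1[symmetric] by simp
    ultimately show False using not_ordLess_ordIso by blast
  qed
  then obtain a where a0: "a \<in> Field ?r" "\<not> (\<exists>b\<in>range j. a \<noteq> b \<and> (a, b) \<in> ?r)"
    unfolding cofinal_def Ball_def by (metis (no_types))
  have a: "a \<in> Field ?r" "\<And>n. \<not> (a \<noteq> j n \<and> (a, j n) \<in> ?r)" using a0 by auto
  \<comment> \<open>The tail strictly above the bound \<open>a\<close> is club, so every stationary
    set meets it.\<close>
  define C where "C = {\<alpha> \<in> Field ?r. a \<noteq> \<alpha> \<and> (a, \<alpha>) \<in> ?r}"
  have up: "range j \<subseteq> underS ?r \<alpha>" if "\<alpha> \<in> C" for \<alpha>
  proof
    fix x assume "x \<in> range j"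
    then obtain n where n: "x = j n" by blast
    have xF: "x \<in> Field ?r" using n j(2) by blast
    have xa: "(x, a) \<in> ?r" using a(1) a(2)[of n] n xF r.TOTALS by (cases "a = x") auto
    have a\<alpha>: "(a, \<alpha>) \<in> ?r" "a \<noteq> \<alpha>" using that unfolding C_def by auto
    have "(x, \<alpha>) \<in> ?r" using transD[OF r.TRANS xa a\<alpha>(1)] .
    moreover have "x \<noteq> \<alpha>" using antisymD[OF r.ANTISYM xa] a\<alpha> by blast
    ultimately show "x \<in> underS ?r \<alpha>" unfolding underS_def by blast
  qed
  have club: "club ?r C"
    unfolding club_def
  proof
    show "closed_below ?r C"
      unfolding closed_below_def
    proof (intro conjI ballI impI)
      fix \<delta> assume \<delta>: "\<delta> \<in> Field ?r"
        "underS ?r \<delta> \<noteq> {} \<and> cofinal (C \<inter> underS ?r \<delta>) (Restr ?r (underS ?r \<delta>))"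
      then obtain x where x: "x \<in> underS ?r \<delta>" by blast
      then have "x \<in> Field ?r" "(x, \<delta>) \<in> ?r" unfolding underS_def by (auto simp: Field_def)
      then have "(x, x) \<in> Restr ?r (underS ?r \<delta>)" using x r.REFL unfolding refl_on_def by blast
      then have "x \<in> Field (Restr ?r (underS ?r \<delta>))" unfolding Field_def by blast
      then obtain y where y: "y \<in> C" "y \<in> underS ?r \<delta>" using \<delta>(2) unfolding cofinal_def by blast
      have ay: "(a, y) \<in> ?r" "a \<noteq> y" using y(1) unfolding C_def by auto
      have y\<delta>: "(y, \<delta>) \<in> ?r" using y(2) unfolding underS_def by blast
      have "(a, \<delta>) \<in> ?r" using transD[OF r.TRANS ay(1) y\<delta>] .
      moreover have "a \<noteq> \<delta>" using antisymD[OF r.ANTISYM ay(1)] y\<delta> ay(2) by blast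
      ultimately show "\<delta> \<in> C" unfolding C_def using \<delta>(1) by blast
    qed (auto simp: C_def)
    show "cofinal C ?r"
      unfolding cofinal_def
    proof
      fix b assume b: "b \<in> Field ?r"
      obtain m where m: "m \<in> Field ?r" "(a, m) \<in> ?r" "(b, m) \<in> ?r"
        using r.TOTALS a(1) b r.REFL unfolding refl_on_def by blast
      obtain c where c: "c \<in> Field ?r" "m \<noteq> c" "(m, c) \<in> ?r"
        using infinite_Card_order_limit[OF r m(1)] by blast
      have "(a, c) \<in> ?r" "(b, c) \<in> ?r" using transD[OF r.TRANS _ c(3)] m by blast+
      moreover have "a \<noteq> c" "b \<noteq> c" using antisymD[OF r.ANTISYM c(3)] m c(2) by blast+
      ultimately show "\<exists>c\<in>C. b \<noteq> c \<and> (b, c) \<in> ?r" unfolding C_def using c(1) by blast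
    qed
  qed
  have "\<exists>\<alpha>. \<alpha> \<in> Field ?r \<and> S \<alpha> = j ` X" for X
  proof -
    have X: "j ` X \<subseteq> Field ?r" using j(2) by blast
    obtain \<alpha> where \<alpha>: "\<alpha> \<in> Field ?r" "j ` X \<inter> underS ?r \<alpha> = S \<alpha>" "\<alpha> \<in> C"
      using S[OF X] club unfolding stationary_def by blast
    have "j ` X \<subseteq> underS ?r \<alpha>" using up[OF \<alpha>(3)] by blast
    then show ?thesis using \<alpha>(1,2) by blast
  qed
  then obtain g where g: "\<And>X. g X \<in> Field ?r \<and> S (g X) = j ` X" by metis
  have "inj g"
  proof (rule injI)
    fix X Y assume "g X = g Y"
    then have "j ` X = j ` Y" using g by metis
    then show "X = Y" using j(1) by (simp add: inj_image_eq_iff)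
  qed
  then have inj: "|UNIV :: nat set set| \<le>o |Field ?r|"
    using g unfolding card_of_ordLeq[symmetric] by blast
  show ?thesis using ordLeq_ordIso_trans[OF inj card_of_Field_ordIso[OF r(1)]] .
qed

section \<open>Transfinite recursion with countable initial segments\<close>

text \<open>\<open>U i\<close> is the state on arrival at \<open>i\<close> and \<open>Z i\<close>
  the state after the step made there, so \<open>D\<close> can compare the two. As initial segments
  are countable, the invariant \<open>P\<close> has to survive only suprema of countable chains. A
  general complete lattice admits pairs of sets under the componentwise order.\<close>

lemma transfinite_chain:
  fixes P :: "'s::complete_lattice \<Rightarrow> bool" and r :: "'i rel"
  assumes r: "Well_order r" and small: "\<And>i. i \<in> Field r \<Longrightarrow> countable (underS r i)"
    and init: "P s0"
    and step: "\<And>i s. i \<in> Field r \<Longrightarrow> P s \<Longrightarrow> \<exists>t. s \<le> t \<and> P t \<and> D i s t"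
    and union: "\<And>A. countable A \<Longrightarrow> A \<noteq> {} \<Longrightarrow> (\<forall>s\<in>A. P s) \<Longrightarrow>
      (\<forall>s\<in>A. \<forall>t\<in>A. s \<le> t \<or> t \<le> s) \<Longrightarrow> P (Sup A)"
  shows "\<exists>Z U. \<forall>i\<in>Field r. P (Z i) \<and> P (U i) \<and> U i \<le> Z i \<and> D i (U i) (Z i) \<and>
    (\<forall>j\<in>underS r i. Z j \<le> U i)"
proof -
  interpret r: wo_rel r using r by (simp add: wo_rel_def)
  define nxt where "nxt i s = (SOME t. s \<le> t \<and> P t \<and> D i s t)" for i s
  have nxt: "s \<le> nxt i s \<and> P (nxt i s) \<and> D i s (nxt i s)" if "i \<in> Field r" "P s" for i s
    unfolding nxt_def using step[OF that] by (rule someI_ex)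
  \<comment> \<open>Inserting \<open>s0\<close> keeps the family nonempty and makes
    \<open>s0\<close> the supremum at the first point.\<close>
  define H where "H z i = nxt i (Sup (insert s0 (z ` underS r i)))" for z i
  define Z where "Z = r.worec H"
  have "r.adm_wo H" unfolding r.adm_wo_def H_def by (auto cong: image_cong)
  then have Z: "Z i = H Z i" for i unfolding Z_def using r.worec_fixpoint by metis
  define U where "U i = Sup (insert s0 (Z ` underS r i))" for i
  have ZU: "Z i = nxt i (U i)" for i by (subst Z) (simp add: H_def U_def)
  have le_U: "Z j \<le> U i" if "j \<in> underS r i" for i j
    unfolding U_def using that by (intro Sup_upper) auto
  have s0_U: "s0 \<le> U i" for i unfolding U_def by (intro Sup_upper) auto
  have PU: "P (U i)" if "i \<in> Field r" for i
    using that
  proof (induction i rule: r.well_order_induct)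
    case (1 i)
    have PUj: "P (U j)" and jF: "j \<in> Field r" if "j \<in> underS r i" for j
    proof -
      show jF: "j \<in> Field r" using that by (auto simp: underS_def Field_def)
      show "P (U j)" using 1 that jF by (auto simp: underS_def)
    qed
    have Zj: "P (Z j)" "U j \<le> Z j" if "j \<in> underS r i" for j
      using nxt[OF jF[OF that] PUj[OF that]] unfolding ZU by auto
    have cmp: "Z j \<le> Z k \<or> Z k \<le> Z j" if jk: "j \<in> underS r i" "k \<in> underS r i" for j k
    proof -
      have "j = k \<or> j \<in> underS r k \<or> k \<in> underS r j"
        using r.TOTAL jF[OF jk(1)] jF[OF jk(2)] unfolding total_on_def underS_def by auto
      then show ?thesis
        using le_U[of j k] le_U[of k j] Zj(2)[OF jk(1)] Zj(2)[OF jk(2)] order_trans by blast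
    qed
    have s0Z: "s0 \<le> Z j" if "j \<in> underS r i" for j
      using s0_U[of j] Zj(2)[OF that] by (rule order_trans)
    show ?case
      unfolding U_def
    proof (rule union)
      show "countable (insert s0 (Z ` underS r i))" using small[OF 1(2)] by simp
      show "\<forall>s\<in>insert s0 (Z ` underS r i). P s" using init Zj(1) by blast
      show "\<forall>s\<in>insert s0 (Z ` underS r i). \<forall>t\<in>insert s0 (Z ` underS r i). s \<le> t \<or> t \<le> s"
        using cmp s0Z by auto
    qed simp
  qed
  show ?thesis
  proof (intro exI ballI conjI)
    fix i assume i: "i \<in> Field r"
    show "P (Z i)" "U i \<le> Z i" "D i (U i) (Z i)" using nxt[OF i PU[OF i]] unfolding ZU by auto
    show "P (U i)" using PU[OF i] .
    fix j assume "j \<in> underS r i" then show "Z j \<le> U i" by (rule le_U)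
  qed
qed

section \<open>Sequences over a domain\<close>

context idom
begin

section \<open>Sequences, adic pairing and purity\<close>

definition unit_seq :: "nat \<Rightarrow> nat \<Rightarrow> 'a" where
  "unit_seq k = (\<lambda>i. if i = k then 1 else 0)"

definition finite_seqs :: "(nat \<Rightarrow> 'a) set" where
  "finite_seqs = {f. \<exists>N. \<forall>i\<ge>N. f i = 0}"

definition null_seqs :: "(nat \<Rightarrow> 'a) set" where
  "null_seqs = {x. \<forall>m. m \<noteq> 0 \<longrightarrow> (\<forall>\<^sub>F i in sequentially. m dvd x i)}"

text \<open>\<open>c\<close> is an \<open>R\<close>-adic limit of the partial sums of the scalar
  product. This is a relation because a limit in the ring may be missing, and over a field every
  \<open>c\<close> would qualify.\<close>

definition pairing :: "(nat \<Rightarrow> 'a) \<Rightarrow> (nat \<Rightarrow> 'a) \<Rightarrow> 'a \<Rightarrow> bool" where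
  "pairing f x c \<longleftrightarrow>
     (\<forall>m. m \<noteq> 0 \<longrightarrow> (\<forall>\<^sub>F n in sequentially. m dvd (\<Sum>i<n. f i * x i) - c))"

text \<open>The product only has to exist in the ring; it need not vanish.\<close>

definition orth :: "(nat \<Rightarrow> 'a) \<Rightarrow> (nat \<Rightarrow> 'a) \<Rightarrow> bool" where
  "orth f x \<longleftrightarrow> (\<exists>c. pairing f x c)"

definition fpair :: "(nat \<Rightarrow> 'a) \<Rightarrow> (nat \<Rightarrow> 'a) \<Rightarrow> 'a" where
  "fpair f u = (\<Sum>i\<in>{i. u i \<noteq> 0}. f i * u i)"

text \<open>These are the submodules of the module of all sequences whose quotient is
  torsion-free.\<close>

definition pure :: "(nat \<Rightarrow> 'a) set \<Rightarrow> bool" where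
  "pure W \<longleftrightarrow> (\<lambda>_. 0) \<in> W \<and> (\<forall>f\<in>W. \<forall>g\<in>W. (\<lambda>i. f i + g i) \<in> W) \<and>
     (\<forall>r. \<forall>f\<in>W. (\<lambda>i. r * f i) \<in> W) \<and>
     (\<forall>s f. s \<noteq> 0 \<longrightarrow> (\<lambda>i. s * f i) \<in> W \<longrightarrow> f \<in> W)"

text \<open>For pure \<open>W\<close>, this is the least pure submodule that contains \<open>W\<close> and \<open>g\<close>.\<close>

definition adjoin :: "(nat \<Rightarrow> 'a) set \<Rightarrow> (nat \<Rightarrow> 'a) \<Rightarrow> (nat \<Rightarrow> 'a) set" where
  "adjoin W g = {f. \<exists>s r. \<exists>w\<in>W. s \<noteq> 0 \<and> (\<forall>i. s * f i = w i + r * g i)}"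

text \<open>The pure closure of the span of a finite list: a sequence belongs to it when some
  nonzero multiple is a linear combination of \<open>gs\<close>. It plays the part of a
  finite-dimensional subspace over the fraction field.\<close>

definition fspan :: "(nat \<Rightarrow> 'a) list \<Rightarrow> (nat \<Rightarrow> 'a) set" where
  "fspan gs = foldr (\<lambda>g W. adjoin W g) gs {\<lambda>_. 0}"

lemma fspan_Nil [simp]: "fspan [] = {\<lambda>_. 0}"
  and fspan_Cons [simp]: "fspan (g # gs) = adjoin (fspan gs) g"
  by (simp_all add: fspan_def)

section \<open>Rules for the pairing\<close>

lemma pairing_commute: "pairing f x c \<longleftrightarrow> pairing x f c"
  by (simp add: pairing_def mult.commute)

lemma orth_commute: "orth f x \<longleftrightarrow> orth x f"
  unfolding orth_def using pairing_commute by blast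

lemma pairing_add:
  assumes "pairing f x c" "pairing g x d"
  shows "pairing (\<lambda>i. f i + g i) x (c + d)"
  unfolding pairing_def
proof (intro allI impI)
  fix m assume "m \<noteq> (0::'a)"
  with assms have "\<forall>\<^sub>F n in sequentially. m dvd (\<Sum>i<n. f i * x i) - c"
    and "\<forall>\<^sub>F n in sequentially. m dvd (\<Sum>i<n. g i * x i) - d"
    by (auto simp: pairing_def)
  then show "\<forall>\<^sub>F n in sequentially. m dvd (\<Sum>i<n. (f i + g i) * x i) - (c + d)"
  proof eventually_elim
    case (elim n)
    then have "m dvd ((\<Sum>i<n. f i * x i) - c) + ((\<Sum>i<n. g i * x i) - d)" by (rule dvd_add)
    also have "\<dots> = (\<Sum>i<n. (f i + g i) * x i) - (c + d)"
      by (simp add: distrib_right sum.distrib algebra_simps)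
    finally show ?case .
  qed
qed

lemma pairing_scale:
  assumes "pairing f x c"
  shows "pairing (\<lambda>i. r * f i) x (r * c)"
  unfolding pairing_def
proof (intro allI impI)
  fix m assume "m \<noteq> (0::'a)"
  with assms have "\<forall>\<^sub>F n in sequentially. m dvd (\<Sum>i<n. f i * x i) - c"
    by (auto simp: pairing_def)
  then show "\<forall>\<^sub>F n in sequentially. m dvd (\<Sum>i<n. r * f i * x i) - r * c"
  proof eventually_elim
    case (elim n)
    then have "m dvd r * ((\<Sum>i<n. f i * x i) - c)" by (rule dvd_mult)
    also have "\<dots> = (\<Sum>i<n. r * f i * x i) - r * c"
      by (simp add: right_diff_distrib sum_distrib_left mult.assoc)
    finally show ?case .
  qed
qed

lemma pairing_diff:
  assumes "pairing f x c" "pairing g x d"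
  shows "pairing (\<lambda>i. f i - g i) x (c - d)"
  using pairing_add[OF assms(1) pairing_scale[OF assms(2), of "- 1"]] by simp

lemma pairing_zero: "pairing (\<lambda>_. 0) x 0"
  by (simp add: pairing_def)

text \<open>Testing the limit modulo \<open>s\<close> shows that \<open>s\<close> divides
  \<open>c\<close>; testing it modulo \<open>s * m\<close> and cancelling \<open>s\<close> gives the
  limit \<open>d\<close>. This is what makes \<open>orth\<close> a pure condition.\<close>

lemma pairing_cancel:
  assumes "s \<noteq> 0" "pairing (\<lambda>i. s * f i) x c"
  obtains d where "c = s * d" "pairing f x d"
proof -
  have eq: "(\<Sum>i<n. s * f i * x i) = s * (\<Sum>i<n. f i * x i)" for n
    by (simp add: sum_distrib_left mult.assoc)
  have ev: "\<forall>\<^sub>F n in sequentially. m dvd s * (\<Sum>i<n. f i * x i) - c" if "m \<noteq> 0" for m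
    using assms(2) that unfolding pairing_def eq by blast
  obtain n where "s dvd s * (\<Sum>i<n. f i * x i) - c"
    using eventually_happens[OF ev[OF assms(1)]] by auto
  then have "s dvd s * (\<Sum>i<n. f i * x i) - (s * (\<Sum>i<n. f i * x i) - c)"
    by (rule dvd_diff[OF dvd_triv_left])
  also have "s * (\<Sum>i<n. f i * x i) - (s * (\<Sum>i<n. f i * x i) - c) = c"
    by (simp add: algebra_simps)
  finally have "s dvd c" .
  then obtain d where d: "c = s * d" by blast
  have "pairing f x d"
    unfolding pairing_def
  proof (intro allI impI)
    fix m assume "m \<noteq> (0::'a)"
    then have "\<forall>\<^sub>F n in sequentially. s * m dvd s * (\<Sum>i<n. f i * x i) - c"
      using ev assms(1) by simp
    then show "\<forall>\<^sub>F n in sequentially. m dvd (\<Sum>i<n. f i * x i) - d"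
    proof eventually_elim
      case (elim n)
      then have "s * m dvd s * ((\<Sum>i<n. f i * x i) - d)"
        by (simp add: d right_diff_distrib)
      then show ?case using assms(1) by simp
    qed
  qed
  with d that show thesis by blast
qed

text \<open>If the limits differed, the congruences modulo \<open>p * (d - c)\<close> would force
  this product to divide \<open>d - c\<close>, making \<open>p\<close> a unit.\<close>

lemma pairing_unique:
  assumes p: "p \<noteq> 0" "\<not> p dvd 1" and "pairing f x c" "pairing f x d"
  shows "c = d"
proof (rule ccontr)
  assume "c \<noteq> d"
  then have nz: "p * (d - c) \<noteq> 0" using p by simp
  have "\<forall>\<^sub>F n in sequentially. p * (d - c) dvd (\<Sum>i<n. f i * x i) - c"
    and "\<forall>\<^sub>F n in sequentially. p * (d - c) dvd (\<Sum>i<n. f i * x i) - d"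
    using assms(3,4) nz unfolding pairing_def by blast+
  then have "\<forall>\<^sub>F n in sequentially. p * (d - c) dvd d - c"
  proof eventually_elim
    case (elim n)
    then have "p * (d - c) dvd ((\<Sum>i<n. f i * x i) - c) - ((\<Sum>i<n. f i * x i) - d)"
      by (rule dvd_diff)
    also have "(\<Sum>i<n. f i * x i) - c - ((\<Sum>i<n. f i * x i) - d) = d - c"
      by (simp add: algebra_simps)
    finally show ?case .
  qed
  then have "p * (d - c) dvd 1 * (d - c)" by (simp add: eventually_const[OF sequentially_bot])
  moreover have "d - c \<noteq> 0" using \<open>c \<noteq> d\<close> by simp
  ultimately have "p dvd 1" by (subst (asm) dvd_mult_cancel_right) blast
  with p show False by simp
qed

lemma fpair_eq:
  assumes "\<forall>i\<ge>N. u i = 0"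
  shows "fpair f u = (\<Sum>i<N. f i * u i)"
  unfolding fpair_def
proof (rule sum.mono_neutral_left)
  show "{i. u i \<noteq> 0} \<subseteq> {..<N}" using assms by (auto simp: not_less[symmetric])
qed auto

lemma fpair_unit_left: "u \<in> finite_seqs \<Longrightarrow> fpair (unit_seq k) u = u k"
proof -
  assume "u \<in> finite_seqs"
  then obtain N where N: "\<forall>i\<ge>N. u i = 0" by (auto simp: finite_seqs_def)
  have "fpair (unit_seq k) u = (\<Sum>i<max N (Suc k). unit_seq k i * u i)"
    using N by (intro fpair_eq) auto
  also have "\<dots> = (\<Sum>i<max N (Suc k). if i = k then u i else 0)"
    by (rule sum.cong) (auto simp: unit_seq_def)
  also have "\<dots> = u k" by (subst sum.delta) auto
  finally show ?thesis .
qed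

lemma fpair_add_right:
  assumes "u \<in> finite_seqs" "v \<in> finite_seqs"
  shows "fpair f (\<lambda>i. a * u i + b * v i) = a * fpair f u + b * fpair f v"
proof -
  obtain M N where M: "\<forall>i\<ge>M. u i = 0" and N: "\<forall>i\<ge>N. v i = 0"
    using assms by (auto simp: finite_seqs_def)
  have "fpair f (\<lambda>i. a * u i + b * v i) = (\<Sum>i<max M N. f i * (a * u i + b * v i))"
    and "fpair f u = (\<Sum>i<max M N. f i * u i)" and "fpair f v = (\<Sum>i<max M N. f i * v i)"
    using M N by (intro fpair_eq; simp)+
  then show ?thesis
    by (simp add: sum.distrib sum_distrib_left algebra_simps)
qed

lemma fpair_add_left:
  "fpair (\<lambda>i. a * f i + b * g i) u = a * fpair f u + b * fpair g u"
  by (simp add: fpair_def sum.distrib sum_distrib_left algebra_simps)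

lemma fpair_scale_left: "fpair (\<lambda>i. a * f i) u = a * fpair f u"
  by (simp add: fpair_def sum_distrib_left mult.assoc)

lemma fpair_relation:
  assumes "\<And>i. s * h i = a * f i + b * g i"
  shows "s * fpair h u = a * fpair f u + b * fpair g u"
proof -
  have "s * fpair h u = fpair (\<lambda>i. s * h i) u" by (simp only: fpair_scale_left)
  also have "\<dots> = fpair (\<lambda>i. a * f i + b * g i) u" by (simp only: assms)
  also have "\<dots> = a * fpair f u + b * fpair g u" by (rule fpair_add_left)
  finally show ?thesis .
qed

lemma finite_seqs_lincomb:
  assumes "u \<in> finite_seqs" "v \<in> finite_seqs"
  shows "(\<lambda>i. a * u i + b * v i) \<in> finite_seqs"
proof -
  obtain M N where "\<forall>i\<ge>M. u i = 0" "\<forall>i\<ge>N. v i = 0"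
    using assms by (auto simp: finite_seqs_def)
  then have "\<forall>i\<ge>max M N. a * u i + b * v i = 0" by simp
  then show ?thesis unfolding finite_seqs_def by blast
qed

lemma unit_seq_finite: "unit_seq k \<in> finite_seqs"
  unfolding finite_seqs_def unit_seq_def by (auto intro!: exI[of _ "Suc k"])

lemma zero_finite: "(\<lambda>_. 0) \<in> finite_seqs"
  by (simp add: finite_seqs_def)

lemma pairing_finite:
  assumes "u \<in> finite_seqs"
  shows "pairing f u (fpair f u)"
proof -
  obtain N where N: "\<forall>i\<ge>N. u i = 0" using assms by (auto simp: finite_seqs_def)
  have "(\<Sum>i<n. f i * u i) - fpair f u = 0" if "n \<ge> N" for n
    using fpair_eq[of n u f] N that by auto
  then show ?thesis unfolding pairing_def eventually_sequentially by (metis dvd_0_right)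
qed

lemma pairing_unit_left: "pairing (unit_seq k) x (x k)"
proof -
  have "fpair x (unit_seq k) = (\<Sum>i<Suc k. x i * unit_seq k i)"
    by (rule fpair_eq) (auto simp: unit_seq_def)
  also have "\<dots> = (\<Sum>i<Suc k. if i = k then x i else 0)"
    by (rule sum.cong) (auto simp: unit_seq_def)
  also have "\<dots> = x k" by simp
  finally show ?thesis
    using pairing_finite[OF unit_seq_finite, of x k] by (simp add: pairing_commute)
qed

section \<open>Pure submodules and pure closures\<close>

lemma pure_zero: "pure W \<Longrightarrow> (\<lambda>_. 0) \<in> W"
  and pure_add: "pure W \<Longrightarrow> f \<in> W \<Longrightarrow> g \<in> W \<Longrightarrow> (\<lambda>i. f i + g i) \<in> W"
  and pure_scale: "pure W \<Longrightarrow> f \<in> W \<Longrightarrow> (\<lambda>i. r * f i) \<in> W"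
  and pure_cancel: "pure W \<Longrightarrow> s \<noteq> 0 \<Longrightarrow> (\<lambda>i. s * f i) \<in> W \<Longrightarrow> f \<in> W"
  unfolding pure_def by blast+

lemma pure_lincomb: "pure W \<Longrightarrow> f \<in> W \<Longrightarrow> g \<in> W \<Longrightarrow> (\<lambda>i. a * f i + b * g i) \<in> W"
  by (intro pure_add pure_scale)

lemma pure_diff: "pure W \<Longrightarrow> f \<in> W \<Longrightarrow> g \<in> W \<Longrightarrow> (\<lambda>i. f i - g i) \<in> W"
  using pure_lincomb[of W f g 1 "- 1"] by simp

lemma pure_null_seqs: "pure null_seqs"
  unfolding pure_def
proof (intro conjI ballI allI impI)
  show "(\<lambda>_. 0) \<in> null_seqs" by (simp add: null_seqs_def)
next
  fix f g assume "f \<in> null_seqs" "g \<in> null_seqs"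
  then show "(\<lambda>i. f i + g i) \<in> null_seqs"
    unfolding null_seqs_def by (auto intro: eventually_elim2)
next
  fix r f assume "f \<in> null_seqs"
  then show "(\<lambda>i. r * f i) \<in> null_seqs"
    unfolding null_seqs_def by (auto elim!: eventually_mono)
next
  fix s f assume s: "s \<noteq> 0" and f: "(\<lambda>i. s * f i) \<in> null_seqs"
  show "f \<in> null_seqs"
    unfolding null_seqs_def
  proof (intro CollectI allI impI)
    fix m assume "m \<noteq> (0::'a)"
    then have "s * m \<noteq> 0" using s by simp
    then have "\<forall>\<^sub>F i in sequentially. s * m dvd s * f i"
      using f unfolding null_seqs_def by blast
    then show "\<forall>\<^sub>F i in sequentially. m dvd f i"
      by (rule eventually_mono) (use s in simp)
  qed
qed

text \<open>Together with \<open>adjoin_least\<close> this reduces \<open>orth\<close> on all of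
  \<open>adjoin W g\<close> to \<open>W\<close> and the generator \<open>g\<close>.\<close>

lemma pure_orth: "pure {f. orth f x}"
  unfolding pure_def orth_def mem_Collect_eq
proof (intro conjI ballI allI impI)
  fix s f assume "s \<noteq> 0" "\<exists>c. pairing (\<lambda>i. s * f i) x c"
  then show "\<exists>c. pairing f x c" by (metis pairing_cancel)
qed (use pairing_zero pairing_add pairing_scale in \<open>blast+\<close>)

lemma finite_subset_null: "finite_seqs \<subseteq> null_seqs"
proof
  fix u assume "u \<in> finite_seqs"
  then obtain N where "\<forall>i\<ge>N. u i = 0" by (auto simp: finite_seqs_def)
  then show "u \<in> null_seqs"
    unfolding null_seqs_def eventually_sequentially by (auto intro!: exI[of _ N])
qed

lemma adjoinI: "s \<noteq> 0 \<Longrightarrow> w \<in> W \<Longrightarrow> (\<And>i. s * f i = w i + r * g i) \<Longrightarrow> f \<in> adjoin W g"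
  unfolding adjoin_def by blast

lemma adjoinE:
  assumes "f \<in> adjoin W g"
  obtains s w r where "s \<noteq> 0" "w \<in> W" "\<forall>i. s * f i = w i + r * g i"
  using assms unfolding adjoin_def by blast

lemma subset_adjoin: "W \<subseteq> adjoin W g"
  by (auto intro!: adjoinI[where s = 1 and r = 0])

lemma mem_adjoin: "pure W \<Longrightarrow> g \<in> adjoin W g"
  using adjoinI[of 1 "\<lambda>_. 0" W g 1 g] pure_zero by simp

lemma adjoin_least:
  assumes "pure P" "W \<subseteq> P" "g \<in> P"
  shows "adjoin W g \<subseteq> P"
proof
  fix f assume "f \<in> adjoin W g"
  then obtain s w r where *: "s \<noteq> 0" "w \<in> W" "\<forall>i. s * f i = w i + r * g i"
    by (rule adjoinE)
  then have "(\<lambda>i. s * f i) \<in> P"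
    using assms pure_lincomb[of P w g 1 r] by auto
  with assms * show "f \<in> P" using pure_cancel by blast
qed

lemma pure_adjoin:
  assumes W: "pure W"
  shows "pure (adjoin W g)"
  unfolding pure_def
proof (intro conjI ballI allI impI)
  show "(\<lambda>_. 0) \<in> adjoin W g" using pure_zero[OF W] subset_adjoin by blast
next
  fix f f' assume "f \<in> adjoin W g" "f' \<in> adjoin W g"
  then obtain s w r s' w' r' where
    *: "s \<noteq> 0" "w \<in> W" "\<forall>i. s * f i = w i + r * g i"
       "s' \<noteq> 0" "w' \<in> W" "\<forall>i. s' * f' i = w' i + r' * g i"
    by (metis adjoinE)
  show "(\<lambda>i. f i + f' i) \<in> adjoin W g"
  proof (rule adjoinI)
    show "s * s' \<noteq> 0" using * by simp
    show "(\<lambda>i. s' * w i + s * w' i) \<in> W" using * W by (intro pure_lincomb)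
    fix i
    have "s * s' * (f i + f' i) = s' * (s * f i) + s * (s' * f' i)"
      by (simp add: algebra_simps)
    also have "\<dots> = s' * (w i + r * g i) + s * (w' i + r' * g i)"
      using *(3,6) by simp
    also have "\<dots> = s' * w i + s * w' i + (s' * r + s * r') * g i"
      by (simp add: algebra_simps)
    finally show "s * s' * (f i + f' i) = s' * w i + s * w' i + (s' * r + s * r') * g i" .
  qed
next
  fix a f assume "f \<in> adjoin W g"
  then obtain s w r where *: "s \<noteq> 0" "w \<in> W" "\<forall>i. s * f i = w i + r * g i"
    by (rule adjoinE)
  show "(\<lambda>i. a * f i) \<in> adjoin W g"
  proof (rule adjoinI)
    show "(\<lambda>i. a * w i) \<in> W" using * W by (intro pure_scale)
    fix i
    have "s * (a * f i) = a * (s * f i)" by (rule mult.left_commute)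
    also have "\<dots> = a * (w i + r * g i)" using *(3) by simp
    also have "\<dots> = a * w i + (a * r) * g i" by (simp add: distrib_left mult.assoc)
    finally show "s * (a * f i) = a * w i + (a * r) * g i" .
  qed fact
next
  fix a f assume "a \<noteq> 0" and "(\<lambda>i. a * f i) \<in> adjoin W g"
  from this(2) obtain s w r where *: "s \<noteq> 0" "w \<in> W" "\<forall>i. s * (a * f i) = w i + r * g i"
    by (rule adjoinE)
  show "f \<in> adjoin W g"
  proof (rule adjoinI)
    show "s * a \<noteq> 0" using *(1) \<open>a \<noteq> 0\<close> by simp
    show "s * a * f i = w i + r * g i" for i unfolding mult.assoc using *(3) by blast
    show "w \<in> W" by (rule *(2))
  qed
qed

lemma pure_fspan: "pure (fspan gs)"
proof (induction gs)
  case Nil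
  show ?case
    unfolding pure_def fspan_Nil
  proof (intro conjI ballI allI impI)
    fix s f assume "s \<noteq> 0" "(\<lambda>i. s * f i) \<in> {\<lambda>_. 0}"
    then have "s * f i = 0" for i by (metis singletonD)
    with \<open>s \<noteq> 0\<close> have "\<forall>i. f i = 0" by simp
    then show "f \<in> {\<lambda>_. 0}" by blast
  qed simp_all
qed (simp add: pure_adjoin)

lemma mem_fspan: "g \<in> set gs \<Longrightarrow> g \<in> fspan gs"
proof (induction gs)
  case (Cons h gs)
  then show ?case
    unfolding fspan_Cons using subset_adjoin mem_adjoin[OF pure_fspan] by (cases "g = h") auto
qed simp

lemma fspan_least: "pure P \<Longrightarrow> set gs \<subseteq> P \<Longrightarrow> fspan gs \<subseteq> P"
  by (induction gs) (simp_all add: adjoin_least pure_zero)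

lemma countable_adjoin:
  assumes "countable W" "countable (UNIV :: 'a set)"
  shows "countable (adjoin W g)"
proof -
  let ?F = "\<lambda>s r w. {f. s \<noteq> 0 \<and> (\<forall>i. s * f i = w i + r * g i)}"
  have "countable (?F s r w)" for s r w
  proof -
    have uniq: "f = f'" if "f \<in> ?F s r w" "f' \<in> ?F s r w" for f f'
    proof
      fix i
      have "s \<noteq> 0" "s * f i = s * f' i" using that by simp_all
      then show "f i = f' i" by simp
    qed
    show ?thesis
    proof (cases "?F s r w = {}")
      case True
      show ?thesis unfolding True by simp
    next
      case False
      then obtain f where "f \<in> ?F s r w" by blast
      then have "?F s r w \<subseteq> {f}" using uniq by blast
      then show ?thesis by (rule countable_subset) simp
    qed
  qed
  then have "countable (\<Union>s. \<Union>r. \<Union>w\<in>W. ?F s r w)"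
    using assms by (intro countable_UN) auto
  moreover have "adjoin W g = (\<Union>s. \<Union>r. \<Union>w\<in>W. ?F s r w)"
    unfolding adjoin_def by blast
  ultimately show ?thesis by simp
qed

section \<open>Linear algebra for finitely many sequences\<close>

text \<open>This is separation by a functional over the fraction field, with denominators cleared.
  The induction corrects both sides: first \<open>f\<close> by a multiple of \<open>g\<close>, then
  the functional by a multiple of one that detects \<open>g\<close>.\<close>

lemma separation:
  assumes "f \<notin> fspan gs"
  shows "\<exists>u\<in>finite_seqs. (\<forall>g\<in>fspan gs. fpair g u = 0) \<and> fpair f u \<noteq> 0"
  using assms
proof (induction gs arbitrary: f)
  case Nil
  then obtain k where "f k \<noteq> 0" by (auto simp: fun_eq_iff)
  have "fpair f (unit_seq k) = f k"
  proof -
    have "fpair f (unit_seq k) = (\<Sum>i<Suc k. f i * unit_seq k i)"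
      by (rule fpair_eq) (auto simp: unit_seq_def)
    also have "\<dots> = (\<Sum>i<Suc k. if i = k then f i else 0)"
      by (rule sum.cong) (auto simp: unit_seq_def)
    also have "\<dots> = f k" by simp
    finally show ?thesis .
  qed
  with \<open>f k \<noteq> 0\<close> have "fpair f (unit_seq k) \<noteq> 0" by simp
  moreover have "fpair (\<lambda>_. 0) (unit_seq k) = 0" by (simp add: fpair_def)
  ultimately show ?case using unit_seq_finite by auto
next
  case (Cons g gs)
  let ?W = "fspan gs"
  have W: "pure ?W" by (rule pure_fspan)
  show ?case
  proof (cases "g \<in> ?W")
    case True
    then have "adjoin ?W g \<subseteq> ?W" using W by (intro adjoin_least subset_refl)
    then have "fspan (g # gs) = ?W" unfolding fspan_Cons using subset_adjoin by blast
    then show ?thesis using Cons.IH[of f] Cons.prems by simp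
  next
    case False
    then obtain v where v: "v \<in> finite_seqs" "\<forall>w\<in>?W. fpair w v = 0" "fpair g v \<noteq> 0"
      using Cons.IH by blast
    define a b where "a = fpair g v" and "b = fpair f v"
    \<comment> \<open>\<open>?f\<close> is chosen to vanish on \<open>v\<close>. If it lay in
      \<open>?W\<close>, then \<open>f\<close> would lie in \<open>adjoin ?W g\<close>.\<close>
    let ?f = "\<lambda>i. a * f i + (- b) * g i"
    have "?f \<notin> ?W"
    proof
      assume "?f \<in> ?W"
      have "f \<in> adjoin ?W g"
      proof (rule adjoinI)
        show "?f \<in> ?W" by fact
        show "a \<noteq> 0" using v by (simp add: a_def)
        show "a * f i = ?f i + b * g i" for i by (simp add: algebra_simps)
      qed
      with Cons show False by simp
    qed
    then obtain u where u: "u \<in> finite_seqs" "\<forall>w\<in>?W. fpair w u = 0" "fpair ?f u \<noteq> 0"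
      using Cons.IH by blast
    define c where "c = fpair g u"
    \<comment> \<open>Subtracting a multiple of \<open>v\<close> makes \<open>g\<close> vanish on
      \<open>?u\<close>, and the value of \<open>f\<close> on \<open>?u\<close> is that of
      \<open>?f\<close> on \<open>u\<close>.\<close>
    let ?u = "\<lambda>i. a * u i + (- c) * v i"
    have fu: "fpair h ?u = a * fpair h u + (- c) * fpair h v" for h
      using u v by (intro fpair_add_right)
    have eq: "fpair f ?u = fpair ?f u"
      unfolding fu unfolding fpair_add_left a_def b_def c_def by (simp add: mult.commute)
    have ann: "fpair h ?u = 0" if h: "h \<in> adjoin ?W g" for h
    proof -
      obtain s w r where *: "s \<noteq> 0" "w \<in> ?W" "\<forall>i. s * h i = w i + r * g i"
        using h by (rule adjoinE)
      have w0: "fpair w ?u = 0" unfolding fu using *(2) u(2) v(2) by simp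
      have g0: "fpair g ?u = 0" unfolding fu unfolding a_def c_def by (simp add: mult.commute)
      have "s * fpair h ?u = 1 * fpair w ?u + r * fpair g ?u"
        by (rule fpair_relation) (use *(3) in simp)
      then have "s * fpair h ?u = 0" unfolding w0 g0 by simp
      then show ?thesis using *(1) by (simp only: mult_eq_0_iff simp_thms)
    qed
    have "\<forall>h\<in>fspan (g # gs). fpair h ?u = 0"
      unfolding fspan_Cons by (rule ballI) (rule ann)
    moreover have "fpair f ?u \<noteq> 0" unfolding eq by (rule u(3))
    ultimately have "(\<forall>h\<in>fspan (g # gs). fpair h ?u = 0) \<and> fpair f ?u \<noteq> 0" ..
    moreover have "?u \<in> finite_seqs" using u(1) v(1) by (rule finite_seqs_lincomb)
    ultimately show ?thesis by (rule bexI[of _ ?u])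
  qed
qed

text \<open>Finitely many linear conditions leave a nonzero solution, even one that starts beyond
  \<open>N\<close>. This freedom drives the induction: two solutions with disjoint supports can be
  combined, with nonzero result, to satisfy one more condition.\<close>

lemma ex_annihilator:
  "\<exists>u\<in>finite_seqs. (\<forall>i<N. u i = 0) \<and> (\<forall>g\<in>set gs. fpair g u = 0) \<and> (\<exists>i. u i \<noteq> 0)"
proof (induction gs arbitrary: N)
  case Nil
  show ?case
    by (rule bexI[OF _ unit_seq_finite[of N]]) (auto simp: unit_seq_def)
next
  case (Cons g gs)
  obtain u where u: "u \<in> finite_seqs" "\<forall>i<N. u i = 0" "\<forall>g\<in>set gs. fpair g u = 0" "\<exists>i. u i \<noteq> 0"
    using Cons by blast
  then obtain M where M: "\<forall>i\<ge>M. u i = 0" by (auto simp: finite_seqs_def)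
  obtain v where v: "v \<in> finite_seqs" "\<forall>i<max M N. v i = 0" "\<forall>g\<in>set gs. fpair g v = 0"
      "\<exists>i. v i \<noteq> 0"
    using Cons by blast
  show ?case
  proof (cases "fpair g u = 0")
    case True
    with u show ?thesis by auto
  next
    case False
    let ?w = "\<lambda>i. fpair g v * u i + (- fpair g u) * v i"
    have fw: "fpair h ?w = fpair g v * fpair h u + (- fpair g u) * fpair h v" for h
      using u v by (intro fpair_add_right)
    obtain i where i: "v i \<noteq> 0" using v by blast
    then have "i \<ge> M" using v by (metis max_less_iff_conj not_less max.strict_coboundedI1)
    then have "?w i \<noteq> 0" using M i False by simp
    moreover have "\<forall>j<N. ?w j = 0" using u v by simp
    moreover have "\<forall>h\<in>set (g # gs). fpair h ?w = 0"
    proof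
      fix h assume "h \<in> set (g # gs)"
      then consider "h = g" | "h \<in> set gs" by auto
      then show "fpair h ?w = 0"
        unfolding fw by cases (use u v in \<open>simp_all add: mult.commute\<close>)
    qed
    ultimately show ?thesis
      by (intro bexI[of _ ?w] finite_seqs_lincomb[OF u(1) v(1)]) blast
  qed
qed

text \<open>Otherwise a nonzero \<open>u\<close> annihilating \<open>gs\<close>, hence all of
  \<open>fspan gs\<close>, would annihilate every unit vector.\<close>

lemma ex_unit_notin_fspan: "\<exists>k. unit_seq k \<notin> fspan gs"
proof (rule ccontr)
  assume *: "\<not> ?thesis"
  obtain u where u: "u \<in> finite_seqs" "\<forall>g\<in>set gs. fpair g u = 0" "\<exists>i. u i \<noteq> 0"
    using ex_annihilator by blast
  have "fpair h u = 0" if "h \<in> fspan gs" for h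
    using that u(2)
  proof (induction gs arbitrary: h)
    case Nil
    then show ?case by (simp add: fpair_def)
  next
    case (Cons g gs)
    then obtain s w r where *: "s \<noteq> 0" "w \<in> fspan gs" "\<forall>i. s * h i = w i + r * g i"
      by simp (rule adjoinE)
    have "s * fpair h u = 1 * fpair w u + r * fpair g u"
      by (rule fpair_relation) (use *(3) in simp)
    with Cons.IH[OF *(2)] Cons.prems(2) *(1) show ?case by simp
  qed
  then show False using * u fpair_unit_left by metis
qed

section \<open>Generic null sequences\<close>

text \<open>This carries congruences from a finite approximation \<open>u\<close> over to the
  partial sums for \<open>x\<close>: past the support of \<open>u\<close> the difference is a sum of
  multiples of \<open>q\<close>.\<close>

lemma eventually_cong_fpair:
  assumes "u \<in> finite_seqs" "\<And>k. q dvd x k - u k"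
  shows "\<forall>\<^sub>F n in sequentially. q dvd (\<Sum>i<n. f i * x i) - fpair f u"
proof -
  obtain N where N: "\<forall>i\<ge>N. u i = 0" using assms(1) by (auto simp: finite_seqs_def)
  have "q dvd (\<Sum>i<n. f i * x i) - fpair f u" if "n \<ge> N" for n
  proof -
    have "fpair f u = (\<Sum>i<n. f i * u i)" using N that by (intro fpair_eq) auto
    moreover have "(\<Sum>i<n. f i * x i) = (\<Sum>i<n. f i * (x i - u i)) + (\<Sum>i<n. f i * u i)"
      unfolding sum.distrib[symmetric] distrib_left[symmetric] by simp
    ultimately have "(\<Sum>i<n. f i * x i) - fpair f u = (\<Sum>i<n. f i * (x i - u i))" by simp
    also have "q dvd \<dots>" by (intro dvd_sum dvd_mult assms(2))
    finally show ?thesis .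
  qed
  then show ?thesis unfolding eventually_sequentially by blast
qed

text \<open>
  Either \<open>v = 0\<close> or a fixed \<open>v = u\<close> works: the two values of \<open>fpair f\<close> differ by \<open>q * fpair f u\<close>,
  and \<open>q'\<close> is chosen so that it does not divide this difference.
\<close>

lemma step_extension:
  assumes p: "p \<noteq> 0" "\<not> p dvd 1" and X: "X \<in> finite_seqs" and q: "q \<noteq> 0" and a: "a \<noteq> 0"
    and f: "f \<notin> fspan gs"
  shows "\<exists>v\<in>finite_seqs. (\<forall>g\<in>fspan gs. fpair g v = 0) \<and>
    (\<exists>q'. q' \<noteq> 0 \<and> q dvd q' \<and> a dvd q' \<and> \<not> q' dvd fpair f (\<lambda>i. 1 * X i + q * v i) - c)"
proof -
  obtain u where u: "u \<in> finite_seqs" "\<forall>g\<in>fspan gs. fpair g u = 0" "fpair f u \<noteq> 0"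
    using separation[OF f] by blast
  define t where "t = fpair f u"
  \<comment> \<open>The factors \<open>q\<close> and \<open>a\<close> give the required
    divisibilities, and \<open>p\<close> keeps \<open>q'\<close> from dividing \<open>q * t\<close>,
    the gap between the two candidate values.\<close>
  define q' where "q' = q * t * p * a"
  have q': "q' \<noteq> 0" "q dvd q'" "a dvd q'"
    using q u(3) p(1) a by (simp_all add: q'_def t_def mult.assoc)
  have nd: "\<not> q' dvd q * t"
  proof
    assume "q' dvd q * t"
    then have "(q * t) * (p * a) dvd (q * t) * 1" by (simp add: q'_def mult.assoc)
    moreover have "q * t \<noteq> 0" using q u(3) by (simp add: t_def)
    ultimately have "p * a dvd 1" by (simp only: dvd_mult_cancel_left) blast
    then show False using p(2) dvd_mult_left by blast
  qed
  show ?thesis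
  proof (cases "q' dvd fpair f X - c")
    case False
    have z: "fpair h (\<lambda>_. 0) = 0" for h by (simp add: fpair_def)
    have "\<not> q' dvd fpair f (\<lambda>i. 1 * X i + q * 0) - c" using False by simp
    with q' z zero_finite show ?thesis by (intro bexI[of _ "\<lambda>_. 0"]) blast+
  next
    case True
    have "\<not> q' dvd fpair f (\<lambda>i. 1 * X i + q * u i) - c"
    proof
      assume "q' dvd fpair f (\<lambda>i. 1 * X i + q * u i) - c"
      then have "q' dvd (1 * fpair f X + q * t) - c"
        unfolding t_def by (simp only: fpair_add_right[OF X u(1)])
      then have "q' dvd ((1 * fpair f X + q * t) - c) - (fpair f X - c)"
        using True by (rule dvd_diff)
      also have "((1 * fpair f X + q * t) - c) - (fpair f X - c) = q * t"
        by (simp add: algebra_simps)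
      finally show False using nd by blast
    qed
    with q' u show ?thesis by (intro bexI[of _ u]) blast+
  qed
qed

text \<open>A demand \<open>d\<close> is a set of pairs \<open>(f, c)\<close>, at least one of which
  must fail to be a pairing with \<open>x\<close>. Demand \<open>e n\<close> is served at step
  \<open>n\<close>: the new modulus does not divide the error
  \<open>fpair f (X (Suc n)) - c\<close>, and all later terms are multiples of that modulus, so the
  failure survives in the limit.\<close>

lemma generic_vector:
  assumes p: "p \<noteq> 0" "\<not> p dvd 1" and cR: "countable (UNIV :: 'a set)"
    and B: "countable B" "\<And>k. unit_seq k \<in> B" and D: "countable D"
    and dem: "\<And>d gs. d \<in> D \<Longrightarrow> set gs \<subseteq> B \<Longrightarrow> \<exists>(f, c)\<in>d. f \<notin> fspan gs"
  shows "\<exists>x\<in>null_seqs. (\<forall>b\<in>B. orth b x) \<and> (\<forall>d\<in>D. \<exists>(f, c)\<in>d. \<not> pairing f x c)"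
proof (cases "D = {}")
  case True
  have "orth b (\<lambda>_. 0)" for b
    unfolding orth_def using pairing_zero pairing_commute by blast
  moreover have "(\<lambda>_. 0) \<in> null_seqs" using pure_null_seqs by (rule pure_zero)
  ultimately show ?thesis using True by blast
next
  case False
  define e where "e = from_nat_into D"
  define b where "b = from_nat_into B"
  \<comment> \<open>Every nonzero ring element occurs among the \<open>a n\<close>. As
    \<open>a n\<close> will divide \<open>q (Suc n)\<close>, each nonzero \<open>m\<close>
    eventually divides the moduli.\<close>
  define a where "a = from_nat_into {m. m \<noteq> (0::'a)}"
  have e: "range e = D" unfolding e_def using False D by (rule range_from_nat_into)
  have b: "range b = B" unfolding b_def using B by (intro range_from_nat_into) auto
  have a: "range a = {m. m \<noteq> 0}"
    unfolding a_def
  proof (rule range_from_nat_into)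
    show "countable {m. m \<noteq> (0::'a)}" using cR by (rule countable_subset[rotated]) simp
  qed (use p in auto)
  \<comment> \<open>A state consists of the partial sum and the current modulus.\<close>
  define P where "P x \<longleftrightarrow> fst x \<in> finite_seqs \<and> snd x \<noteq> 0" for x :: "(nat \<Rightarrow> 'a) \<times> 'a"
  define Q where "Q n x y \<longleftrightarrow> (\<exists>v\<in>finite_seqs. fst y = (\<lambda>i. 1 * fst x i + snd x * v i) \<and>
      (\<forall>j<n. fpair (b j) v = 0)) \<and> snd x dvd snd y \<and> a n dvd snd y \<and>
      (\<exists>(f, c)\<in>e n. \<not> snd y dvd fpair f (fst y) - c)"
    for n :: nat and x y :: "(nat \<Rightarrow> 'a) \<times> 'a"
  have step: "\<exists>y. P y \<and> Q n x y" if "P x" for n x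
  proof -
    from that have X: "fst x \<in> finite_seqs" and q: "snd x \<noteq> 0" by (auto simp: P_def)
    have "e n \<in> D" "set (map b [0..<n]) \<subseteq> B" using e b by auto
    then obtain f c where fc: "(f, c) \<in> e n" "f \<notin> fspan (map b [0..<n])"
      using dem by blast
    have "a n \<noteq> 0" using a by blast
    then obtain v q' where v: "v \<in> finite_seqs" "\<forall>g\<in>fspan (map b [0..<n]). fpair g v = 0"
      "q' \<noteq> 0" "snd x dvd q'" "a n dvd q'"
      "\<not> q' dvd fpair f (\<lambda>i. 1 * fst x i + snd x * v i) - c"
      using step_extension[OF p X q _ fc(2)] by blast
    define y where "y = (\<lambda>i. 1 * fst x i + snd x * v i, q')"
    have y: "fst y = (\<lambda>i. 1 * fst x i + snd x * v i)" "snd y = q'"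
      unfolding y_def by (rule fst_conv, rule snd_conv)
    have "b j \<in> fspan (map b [0..<n])" if "j < n" for j
      using that by (intro mem_fspan) auto
    then have "\<forall>j<n. fpair (b j) v = 0" using v(2) by blast
    moreover have "P y"
      unfolding P_def y using finite_seqs_lincomb[OF X v(1)] v(3) by blast
    moreover have "\<exists>(f, c)\<in>e n. \<not> snd y dvd fpair f (fst y) - c"
      unfolding y by (rule bexI[OF _ fc(1)]) (simp only: prod.case v(6) not_False_eq_True)
    ultimately have "P y \<and> Q n x y"
      unfolding Q_def using y v(1,4,5) by blast
    then show ?thesis ..
  qed
  have "\<exists>F. \<forall>n. P (F n) \<and> Q n (F n) (F (Suc n))"
  proof (rule dependent_nat_choice)
    have "P (\<lambda>_. 0, 1)" unfolding P_def using zero_finite by simp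
    then show "\<exists>x. P x" ..
  qed (rule step)
  then obtain F where PF: "\<And>n. P (F n)" and QF: "\<And>n. Q n (F n) (F (Suc n))" by blast
  define X q where "X n = fst (F n)" and "q n = snd (F n)" for n
  have XF: "X n \<in> finite_seqs" "q n \<noteq> 0" for n
    using PF[of n] unfolding P_def X_def q_def by blast+
  have XS: "\<exists>v\<in>finite_seqs. X (Suc n) = (\<lambda>i. 1 * X n i + q n * v i) \<and>
    (\<forall>j<n. fpair (b j) v = 0)"
    and qS: "q n dvd q (Suc n)" "a n dvd q (Suc n)"
    and eS: "\<exists>(f, c)\<in>e n. \<not> q (Suc n) dvd fpair f (X (Suc n)) - c" for n
    using QF[of n] unfolding Q_def X_def q_def by blast+
  have q_mono: "q n dvd q m" if "n \<le> m" for n m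
    using that by (induction m rule: dec_induct) (auto intro: dvd_trans qS)
  have q_all: "\<exists>N. \<forall>n\<ge>N. m dvd q n" if "m \<noteq> 0" for m
  proof -
    have "m \<in> range a" using that a by simp
    then obtain n where "m = a n" by blast
    then have "m dvd q (Suc n)" using qS(2) by simp
    then show ?thesis using q_mono dvd_trans by blast
  qed
  \<comment> \<open>From index \<open>Suc j\<close> on every added vector pairs to zero with
    \<open>b j\<close>, so the value at \<open>b j\<close> is final.\<close>
  have fX: "fpair (b j) (X n) = fpair (b j) (X (Suc j))" if "Suc j \<le> n" for j n
    using that
  proof (induction n rule: dec_induct)
    case (step n)
    obtain v where v: "v \<in> finite_seqs" "X (Suc n) = (\<lambda>i. 1 * X n i + q n * v i)"
      "\<forall>j<n. fpair (b j) v = 0" using XS by blast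
    have "fpair (b j) (X (Suc n)) = 1 * fpair (b j) (X n) + q n * fpair (b j) v"
      unfolding v(2) using XF(1) v(1) by (rule fpair_add_right)
    with v(3) step show ?case by simp
  qed simp
  \<comment> \<open>Since \<open>B\<close> contains the unit vectors, each coordinate of
    \<open>X n\<close> becomes constant, so the limit has its coordinates in the ring.\<close>
  have "\<exists>J. \<forall>n\<ge>J. X n k = X J k" for k
  proof -
    obtain j where "unit_seq k = b j" using B(2) b by blast
    then have "X n k = X (Suc j) k" if "n \<ge> Suc j" for n
      using fX[OF that] XF(1) fpair_unit_left by metis
    then show ?thesis by blast
  qed
  then obtain J where J: "\<And>k n. n \<ge> J k \<Longrightarrow> X n k = X (J k) k" by metis
  define x where "x k = X (J k) k" for k
  have X_cong: "q n dvd X m k - X n k" if "n \<le> m" for n m k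
    using that
  proof (induction m rule: dec_induct)
    case (step m)
    obtain v where v: "X (Suc m) = (\<lambda>i. 1 * X m i + q m * v i)" using XS by blast
    have "q n dvd q m * v k + (X m k - X n k)"
      using step q_mono by (intro dvd_add dvd_mult2) auto
    also have "q m * v k + (X m k - X n k) = X (Suc m) k - X n k"
      unfolding v by (simp add: algebra_simps)
    finally show ?case .
  qed simp
  have x_cong: "q n dvd x k - X n k" for n k
  proof -
    have "q n dvd X (max n (J k)) k - X n k" by (rule X_cong) simp
    then show ?thesis unfolding x_def using J[of k "max n (J k)"] by simp
  qed
  have "x \<in> null_seqs"
    unfolding null_seqs_def
  proof (intro CollectI allI impI)
    fix m assume "m \<noteq> (0::'a)"
    then obtain n where n: "m dvd q n" using q_all by blast
    obtain N where N: "\<forall>i\<ge>N. X n i = 0" using XF(1) unfolding finite_seqs_def by blast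
    have "m dvd x i" if "i \<ge> N" for i
      using dvd_trans[OF n x_cong[of n i]] N that by simp
    then show "\<forall>\<^sub>F i in sequentially. m dvd x i" unfolding eventually_sequentially by blast
  qed
  moreover have "orth g x" if gB: "g \<in> B" for g
  proof -
    obtain j where g: "g = b j" using gB b by blast
    have "pairing g x (fpair g (X (Suc j)))"
      unfolding pairing_def
    proof (intro allI impI)
      fix m assume "m \<noteq> (0::'a)"
      then obtain N where N: "\<forall>n\<ge>N. m dvd q n" using q_all by blast
      define n where "n = max N (Suc j)"
      have "\<forall>\<^sub>F K in sequentially. q n dvd (\<Sum>i<K. g i * x i) - fpair g (X n)"
        using XF(1) x_cong by (rule eventually_cong_fpair)
      moreover have "fpair g (X n) = fpair g (X (Suc j))" unfolding g by (rule fX) (simp add: n_def)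
      moreover have "m dvd q n" using N by (simp add: n_def)
      ultimately show "\<forall>\<^sub>F K in sequentially. m dvd (\<Sum>i<K. g i * x i) - fpair g (X (Suc j))"
        by (auto elim!: eventually_mono dvd_trans)
    qed
    then show ?thesis unfolding orth_def by blast
  qed
  moreover have "\<exists>(f, c)\<in>d. \<not> pairing f x c" if dD: "d \<in> D" for d
  proof -
    obtain n where n: "d = e n" using dD e by blast
    obtain f c where fc: "(f, c) \<in> e n" "\<not> q (Suc n) dvd fpair f (X (Suc n)) - c"
      using eS by blast
    have "\<not> pairing f x c"
    proof
      assume "pairing f x c"
      then have "\<forall>\<^sub>F K in sequentially. q (Suc n) dvd (\<Sum>i<K. f i * x i) - c"
        using XF(2) unfolding pairing_def by blast
      moreover have "\<forall>\<^sub>F K in sequentially. q (Suc n) dvd (\<Sum>i<K. f i * x i) - fpair f (X (Suc n))"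
        using XF(1) x_cong by (rule eventually_cong_fpair)
      ultimately have "\<forall>\<^sub>F K in sequentially. q (Suc n) dvd fpair f (X (Suc n)) - c"
      proof eventually_elim
        case (elim K)
        then have "q (Suc n) dvd ((\<Sum>i<K. f i * x i) - c) - ((\<Sum>i<K. f i * x i) - fpair f (X (Suc n)))"
          by (rule dvd_diff)
        also have "((\<Sum>i<K. f i * x i) - c) - ((\<Sum>i<K. f i * x i) - fpair f (X (Suc n))) =
            fpair f (X (Suc n)) - c"
          by (simp add: algebra_simps)
        finally show ?case .
      qed
      then show False using fc(2) by (simp add: eventually_const[OF sequentially_bot])
    qed
    with fc(1) n show ?thesis by blast
  qed
  ultimately show ?thesis by blast
qed

section \<open>The dual pair\<close>

text \<open>The invariant of the construction. Maximality of the two sides with respect to each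
  other is expressed separately, by \<open>covered\<close>.\<close>

definition dual_pair :: "(nat \<Rightarrow> 'a) set \<Rightarrow> (nat \<Rightarrow> 'a) set \<Rightarrow> bool" where
  "dual_pair G H \<longleftrightarrow> pure G \<and> pure H \<and> finite_seqs \<subseteq> G \<and> finite_seqs \<subseteq> H \<and>
     G \<subseteq> null_seqs \<and> H \<subseteq> null_seqs \<and> (\<forall>g\<in>G. \<forall>h\<in>H. orth g h)"

lemma dual_pair_swap: "dual_pair G H \<Longrightarrow> dual_pair H G"
  unfolding dual_pair_def using orth_commute by blast

lemma pure_finite_seqs: "pure finite_seqs"
  unfolding pure_def
proof (intro conjI ballI allI impI)
  show "(\<lambda>_. 0) \<in> finite_seqs" by (rule zero_finite)
next
  fix f g assume "f \<in> finite_seqs" "g \<in> finite_seqs"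
  then show "(\<lambda>i. f i + g i) \<in> finite_seqs" using finite_seqs_lincomb[of f g 1 1] by simp
next
  fix r f assume "f \<in> finite_seqs"
  then show "(\<lambda>i. r * f i) \<in> finite_seqs" using finite_seqs_lincomb[of f f r 0] by simp
next
  fix s f assume "s \<noteq> 0" "(\<lambda>i. s * f i) \<in> finite_seqs"
  then show "f \<in> finite_seqs" by (simp add: finite_seqs_def)
qed

lemma dual_pair_finite_seqs: "dual_pair finite_seqs finite_seqs"
  unfolding dual_pair_def orth_def
  using pure_finite_seqs finite_subset_null pairing_finite by blast

lemma countable_finite_seqs:
  assumes "countable (UNIV :: 'a set)"
  shows "countable finite_seqs"
proof (rule countable_subset)
  show "finite_seqs \<subseteq> range (\<lambda>xs i. if i < length xs then xs ! i else 0)"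
  proof
    fix f assume "f \<in> finite_seqs"
    then obtain N where N: "\<forall>i\<ge>N. f i = 0" by (auto simp: finite_seqs_def)
    have "f = (\<lambda>i. if i < length (map f [0..<N]) then map f [0..<N] ! i else 0)"
    proof
      fix i
      show "f i = (if i < length (map f [0..<N]) then map f [0..<N] ! i else 0)"
        using N by (cases "i < N") simp_all
    qed
    then show "f \<in> range (\<lambda>xs i. if i < length xs then xs ! i else 0)" by (rule range_eqI)
  qed
  have "countable (UNIV :: 'a list set)" using countable_lists[OF assms] by simp
  then show "countable (range (\<lambda>xs i. if i < length xs then xs ! i else (0::'a)))"
    by (rule countable_image)
qed

lemma dual_pair_adjoin:
  assumes "dual_pair G H" "x \<in> null_seqs" "\<And>h. h \<in> H \<Longrightarrow> orth h x"
  shows "dual_pair (adjoin G x) H"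
proof -
  have d: "pure G" "pure H" "finite_seqs \<subseteq> G" "finite_seqs \<subseteq> H" "G \<subseteq> null_seqs" "H \<subseteq> null_seqs"
    "\<forall>g\<in>G. \<forall>h\<in>H. orth g h"
    using assms(1) unfolding dual_pair_def by blast+
  have "adjoin G x \<subseteq> {g. orth g h}" if "h \<in> H" for h
  proof (rule adjoin_least[OF pure_orth])
    show "G \<subseteq> {g. orth g h}" using d(7) that by blast
    show "x \<in> {g. orth g h}" using assms(3)[OF that] orth_commute by blast
  qed
  moreover have "adjoin G x \<subseteq> null_seqs" by (rule adjoin_least[OF pure_null_seqs d(5) assms(2)])
  moreover have "pure (adjoin G x)" using d(1) by (rule pure_adjoin)
  moreover have "finite_seqs \<subseteq> adjoin G x" using d(3) subset_adjoin by blast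
  ultimately show ?thesis unfolding dual_pair_def using d by blast
qed

text \<open>
  In the first two cases no endomorphism of a pure submodule of \<open>S\<close> between \<open>G\<close> and the orthogonal complement of
  \<open>H\<close> can have the columns \<open>C k\<close>; in the third case an endomorphism \<open>\<phi>\<close> with these columns is
  such that \<open>s \<phi> - r\<close> has finite rank.
\<close>

definition treated :: "(nat \<Rightarrow> nat \<Rightarrow> 'a) \<Rightarrow> (nat \<Rightarrow> 'a) set \<Rightarrow> (nat \<Rightarrow> 'a) set \<Rightarrow> bool" where
  "treated C G H \<longleftrightarrow>
     (\<exists>k. \<exists>x\<in>G. \<not> orth (C k) x) \<or>
     (\<exists>x\<in>G. \<exists>y. \<exists>h\<in>H. (\<forall>k. pairing (C k) x (y k)) \<and> \<not> orth y h) \<or>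
     (\<exists>s r gs. s \<noteq> 0 \<and> set gs \<subseteq> H \<and> (\<forall>k. (\<lambda>i. s * C k i - r * unit_seq k i) \<in> fspan gs))"

lemma treated_mono: "treated C G H \<Longrightarrow> G \<subseteq> G' \<Longrightarrow> H \<subseteq> H' \<Longrightarrow> treated C G' H'"
  unfolding treated_def by (elim disjE) (blast, blast, meson order_trans)

text \<open>For a dual pair and all \<open>f\<close> together, this makes \<open>H\<close> the full
  orthogonal complement of \<open>G\<close>. For a single \<open>f\<close> it is settled by a
  witness that persists when \<open>G\<close> and \<open>H\<close> grow.\<close>

definition covered :: "(nat \<Rightarrow> 'a) \<Rightarrow> (nat \<Rightarrow> 'a) set \<Rightarrow> (nat \<Rightarrow> 'a) set \<Rightarrow> bool" where
  "covered f G H \<longleftrightarrow> f \<in> H \<or> (\<exists>x\<in>G. \<not> orth f x)"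

lemma covered_mono: "covered f G H \<Longrightarrow> G \<subseteq> G' \<Longrightarrow> H \<subseteq> H' \<Longrightarrow> covered f G' H'"
  unfolding covered_def by blast

section \<open>One-step extensions of countable dual pairs\<close>

context
  fixes p :: 'a
  assumes p: "p \<noteq> 0" "\<not> p dvd 1" and cR: "countable (UNIV :: 'a set)"
begin

text \<open>\<open>generic_vector\<close> is applied with \<open>H\<close> as the set
  \<open>B\<close>, so that \<open>x\<close> can be adjoined to \<open>G\<close> while
  \<open>H\<close> stays fixed.\<close>

lemma extend_generic:
  assumes GH: "dual_pair G H" and ct: "countable G" "countable H" and D: "countable D"
    and dem: "\<And>d gs. d \<in> D \<Longrightarrow> set gs \<subseteq> H \<Longrightarrow> \<exists>(f, c)\<in>d. f \<notin> fspan gs"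
  shows "\<exists>x. dual_pair (adjoin G x) H \<and> countable (adjoin G x) \<and> G \<subseteq> adjoin G x \<and>
    x \<in> adjoin G x \<and> (\<forall>d\<in>D. \<exists>(f, c)\<in>d. \<not> pairing f x c)"
proof -
  have "unit_seq k \<in> H" for k using GH unit_seq_finite unfolding dual_pair_def by blast
  then obtain x where x: "x \<in> null_seqs" "\<forall>b\<in>H. orth b x" "\<forall>d\<in>D. \<exists>(f, c)\<in>d. \<not> pairing f x c"
    using generic_vector[OF p cR ct(2) _ D dem] by blast
  have "dual_pair (adjoin G x) H" using GH x by (intro dual_pair_adjoin) auto
  moreover have "countable (adjoin G x)" using ct(1) cR by (rule countable_adjoin)
  moreover have "x \<in> adjoin G x" using GH unfolding dual_pair_def by (intro mem_adjoin) blast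
  ultimately show ?thesis using x(3) subset_adjoin by blast
qed

text \<open>For \<open>f\<close> outside \<open>H\<close> there is one demand for each ring element
  \<open>c\<close>, countably many in all; if every \<open>c\<close> fails, \<open>f\<close> and
  \<open>x\<close> have no product. Purity keeps \<open>fspan gs\<close> inside \<open>H\<close>,
  hence away from \<open>f\<close>.\<close>

lemma extend_covered:
  assumes GH: "dual_pair G H" "countable G" "countable H"
  shows "\<exists>G'. G \<subseteq> G' \<and> dual_pair G' H \<and> countable G' \<and> covered f G' H"
proof (cases "f \<in> H")
  case True
  then show ?thesis using GH unfolding covered_def by blast
next
  case False
  let ?D = "(\<lambda>c. {(f, c)}) ` (UNIV :: 'a set)"
  have "\<exists>x. dual_pair (adjoin G x) H \<and> countable (adjoin G x) \<and> G \<subseteq> adjoin G x \<and>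
    x \<in> adjoin G x \<and> (\<forall>d\<in>?D. \<exists>(f, c)\<in>d. \<not> pairing f x c)"
  proof (rule extend_generic[OF GH])
    show "countable ?D" by (rule countable_image[OF cR])
    fix d gs assume d: "d \<in> ?D" and gs: "set gs \<subseteq> H"
    have "fspan gs \<subseteq> H" using GH(1) gs unfolding dual_pair_def by (intro fspan_least) auto
    then show "\<exists>(f, c)\<in>d. f \<notin> fspan gs" using False d by auto
  qed
  then obtain x where x: "dual_pair (adjoin G x) H" "countable (adjoin G x)" "G \<subseteq> adjoin G x"
    "x \<in> adjoin G x" "\<forall>d\<in>?D. \<exists>(f, c)\<in>d. \<not> pairing f x c" by blast
  then have "\<not> orth f x" unfolding orth_def by auto
  with x show ?thesis unfolding covered_def by blast
qed

text \<open>The demand for \<open>g\<close> makes \<open>x\<close> differ from \<open>g\<close> in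
  some coordinate, as pairing with \<open>unit_seq k\<close> reads off coordinate \<open>k\<close>.
  It can be met because no \<open>fspan gs\<close> contains all unit vectors.\<close>

lemma extend_proper:
  assumes GH: "dual_pair G H" "countable G" "countable H"
  shows "\<exists>G'. G \<subset> G' \<and> dual_pair G' H \<and> countable G'"
proof -
  let ?D = "(\<lambda>g. range (\<lambda>k. (unit_seq k, g k))) ` G"
  have "\<exists>x. dual_pair (adjoin G x) H \<and> countable (adjoin G x) \<and> G \<subseteq> adjoin G x \<and>
    x \<in> adjoin G x \<and> (\<forall>d\<in>?D. \<exists>(f, c)\<in>d. \<not> pairing f x c)"
  proof (rule extend_generic[OF GH])
    show "countable ?D" by (rule countable_image[OF GH(2)])
    fix d gs assume "d \<in> ?D"
    then show "\<exists>(f, c)\<in>d. f \<notin> fspan gs" using ex_unit_notin_fspan[of gs] by auto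
  qed
  then obtain x where x: "dual_pair (adjoin G x) H" "countable (adjoin G x)" "G \<subseteq> adjoin G x"
    "x \<in> adjoin G x" "\<forall>d\<in>?D. \<exists>(f, c)\<in>d. \<not> pairing f x c" by blast
  have "x \<notin> G"
  proof
    assume "x \<in> G"
    then obtain k where "\<not> pairing (unit_seq k) x (x k)" using x(5) by auto
    then show False using pairing_unit_left by blast
  qed
  with x show ?thesis by blast
qed

text \<open>If some \<open>C k\<close> is outside \<open>H\<close>, covering it gives the first
  alternative of \<open>treated\<close>. If all are inside and the third alternative fails, a new
  \<open>x\<close> is chosen whose would-be image \<open>y\<close> is not in
  \<open>adjoin G x\<close>; covering \<open>y\<close> from the other side then gives the
  second.\<close>

lemma extend_treated:
  assumes GH: "dual_pair G H" "countable G" "countable H"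
  shows "\<exists>G' H'. G \<subseteq> G' \<and> H \<subseteq> H' \<and> dual_pair G' H' \<and> countable G' \<and> countable H' \<and>
    treated C G' H'"
proof (cases "\<forall>k. C k \<in> H")
  case False
  then obtain k where k: "C k \<notin> H" by blast
  obtain G' where G': "G \<subseteq> G'" "dual_pair G' H" "countable G'" "covered (C k) G' H"
    using extend_covered[OF GH, of "C k"] by (elim exE conjE)
  then have "\<exists>x\<in>G'. \<not> orth (C k) x" using k unfolding covered_def by blast
  then have "treated C G' H" unfolding treated_def by (intro disjI1 exI)
  with G' GH(3) subset_refl[of H] show ?thesis by (intro exI conjI)
next
  case CH: True
  define A where "A s r k = (\<lambda>i. s * C k i - r * unit_seq k i)" for s r k
  show ?thesis
  proof (cases "\<exists>s r gs. s \<noteq> 0 \<and> set gs \<subseteq> H \<and> (\<forall>k. A s r k \<in> fspan gs)")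
    case True
    then have "treated C G H" unfolding treated_def A_def by (rule disjI2[OF disjI2])
    with GH show ?thesis by blast
  next
    case False
    let ?I = "({s. s \<noteq> 0} \<times> UNIV) \<times> G"
    \<comment> \<open>The demand for \<open>(s, r, g)\<close> excludes
      \<open>s * y - r * x = g\<close>. Over all nonzero \<open>s\<close>, all \<open>r\<close> and
      all \<open>g\<close> in \<open>G\<close>, this excludes every way in which \<open>y\<close>
      could lie in \<open>adjoin G x\<close>.\<close>
    define dm where "dm s r g = range (\<lambda>k. (A s r k, g k :: 'a))" for s r g
    let ?D = "(\<lambda>z. dm (fst (fst z)) (snd (fst z)) (snd z)) ` ?I"
    have "\<exists>x. dual_pair (adjoin G x) H \<and> countable (adjoin G x) \<and> G \<subseteq> adjoin G x \<and>
      x \<in> adjoin G x \<and> (\<forall>d\<in>?D. \<exists>(f, c)\<in>d. \<not> pairing f x c)"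
    proof (rule extend_generic[OF GH])
      have "countable {s. s \<noteq> (0::'a)}" using cR by (rule countable_subset[rotated]) simp
      then show "countable ?D" using GH(2) cR by (intro countable_image countable_SIGMA)
      fix d gs assume "d \<in> ?D" and gs: "set gs \<subseteq> H"
      then obtain z where z: "z \<in> ?I" "d = dm (fst (fst z)) (snd (fst z)) (snd z)" by blast
      then have "fst (fst z) \<noteq> 0" by (simp add: mem_Times_iff)
      then obtain k where "A (fst (fst z)) (snd (fst z)) k \<notin> fspan gs" using False gs by blast
      moreover have "(A (fst (fst z)) (snd (fst z)) k, snd z k) \<in> d" unfolding z(2) dm_def by simp
      ultimately show "\<exists>(f, c)\<in>d. f \<notin> fspan gs" by blast
    qed
    then obtain x where x: "dual_pair (adjoin G x) H" "countable (adjoin G x)" "G \<subseteq> adjoin G x"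
      "x \<in> adjoin G x" "\<forall>d\<in>?D. \<exists>(f, c)\<in>d. \<not> pairing f x c" by blast
    have "orth x (C k)" for k
      using x(1,4) CH unfolding dual_pair_def by blast
    then have "\<forall>k. \<exists>c. pairing (C k) x c" using orth_commute unfolding orth_def by blast
    from choice[OF this] obtain y where y: "\<And>k. pairing (C k) x (y k)" by blast
    have "y \<notin> adjoin G x"
    proof
      assume "y \<in> adjoin G x"
      then obtain s g r where *: "s \<noteq> 0" "g \<in> G" "\<forall>i. s * y i = g i + r * x i"
        by (rule adjoinE)
      have "((s, r), g) \<in> ?I" using *(1,2) by simp
      then have "dm (fst (fst ((s, r), g))) (snd (fst ((s, r), g))) (snd ((s, r), g)) \<in> ?D"
        by (rule imageI)
      then have "dm s r g \<in> ?D" unfolding fst_conv snd_conv .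
      then have "\<exists>(f, c)\<in>dm s r g. \<not> pairing f x c" using x(5) by blast
      then obtain k where k: "\<not> pairing (A s r k) x (g k)" unfolding dm_def by blast
      have "pairing (A s r k) x (s * y k - r * x k)"
        unfolding A_def by (intro pairing_diff pairing_scale y pairing_unit_left)
      moreover have "s * y k - r * x k = g k" using *(3) by simp
      ultimately show False using k by simp
    qed
    \<comment> \<open>The two sides exchange their roles: now \<open>H\<close> is enlarged and
      \<open>adjoin G x\<close> stays fixed.\<close>
    moreover obtain H' where H': "H \<subseteq> H'" "dual_pair H' (adjoin G x)" "countable H'"
      "covered y H' (adjoin G x)"
      using extend_covered[OF dual_pair_swap[OF x(1)] GH(3) x(2), of y] by (elim exE conjE)
    ultimately have "\<exists>h\<in>H'. \<not> orth y h" unfolding covered_def by blast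
    then have "treated C (adjoin G x) H'" using x(4) y unfolding treated_def by blast
    then show ?thesis using x(2,3) H' dual_pair_swap by blast
  qed
qed

end

section \<open>Unions of chains and the transfinite construction\<close>

lemma pure_Union:
  assumes "\<W> \<noteq> {}" "\<And>W. W \<in> \<W> \<Longrightarrow> pure W" "\<And>V W. V \<in> \<W> \<Longrightarrow> W \<in> \<W> \<Longrightarrow> V \<subseteq> W \<or> W \<subseteq> V"
  shows "pure (\<Union>\<W>)"
  unfolding pure_def
proof (intro conjI ballI allI impI)
  show "(\<lambda>_. 0) \<in> \<Union>\<W>" using assms(1,2) pure_zero by blast
next
  fix f g assume "f \<in> \<Union>\<W>" "g \<in> \<Union>\<W>"
  then obtain V W where VW: "V \<in> \<W>" "W \<in> \<W>" "f \<in> V" "g \<in> W" by blast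
  then obtain X where "X \<in> \<W>" "f \<in> X" "g \<in> X" using assms(3)[OF VW(1,2)] by blast
  then show "(\<lambda>i. f i + g i) \<in> \<Union>\<W>" using pure_add[OF assms(2)] by blast
next
  fix r f assume "f \<in> \<Union>\<W>"
  then show "(\<lambda>i. r * f i) \<in> \<Union>\<W>" using pure_scale[OF assms(2)] by blast
next
  fix s f assume "s \<noteq> 0" "(\<lambda>i. s * f i) \<in> \<Union>\<W>"
  then show "f \<in> \<Union>\<W>" using pure_cancel[OF assms(2)] by blast
qed

lemma dual_pair_Union:
  assumes ne: "\<A> \<noteq> {}" and dp: "\<And>s. s \<in> \<A> \<Longrightarrow> dual_pair (fst s) (snd s)"
    and chain: "\<And>s t. s \<in> \<A> \<Longrightarrow> t \<in> \<A> \<Longrightarrow> s \<le> t \<or> t \<le> s"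
  shows "dual_pair (\<Union>(fst ` \<A>)) (\<Union>(snd ` \<A>))"
proof -
  have cmp: "fst s \<subseteq> fst t \<and> snd s \<subseteq> snd t \<or> fst t \<subseteq> fst s \<and> snd t \<subseteq> snd s"
    if "s \<in> \<A>" "t \<in> \<A>" for s t
    using chain[OF that] unfolding less_eq_prod_def by blast
  have p: "pure (\<Union>(fst ` \<A>))"
  proof (rule pure_Union)
    show "fst ` \<A> \<noteq> {}" using ne by blast
    show "pure W" if "W \<in> fst ` \<A>" for W using that dp unfolding dual_pair_def by blast
    show "V \<subseteq> W \<or> W \<subseteq> V" if "V \<in> fst ` \<A>" "W \<in> fst ` \<A>" for V W using that cmp by blast
  qed
  have q: "pure (\<Union>(snd ` \<A>))"
  proof (rule pure_Union)
    show "snd ` \<A> \<noteq> {}" using ne by blast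
    show "pure W" if "W \<in> snd ` \<A>" for W using that dp unfolding dual_pair_def by blast
    show "V \<subseteq> W \<or> W \<subseteq> V" if "V \<in> snd ` \<A>" "W \<in> snd ` \<A>" for V W using that cmp by blast
  qed
  have o: "orth g h" if gh: "g \<in> \<Union>(fst ` \<A>)" "h \<in> \<Union>(snd ` \<A>)" for g h
  proof -
    obtain s t where st: "s \<in> \<A>" "t \<in> \<A>" "g \<in> fst s" "h \<in> snd t" using gh by blast
    then obtain z where "z \<in> \<A>" "g \<in> fst z" "h \<in> snd z" using cmp[OF st(1,2)] by blast
    then show ?thesis using dp unfolding dual_pair_def by blast
  qed
  have d: "finite_seqs \<subseteq> fst s" "finite_seqs \<subseteq> snd s" "fst s \<subseteq> null_seqs" "snd s \<subseteq> null_seqs"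
    if "s \<in> \<A>" for s
    using dp[OF that] unfolding dual_pair_def by simp_all
  have "finite_seqs \<subseteq> \<Union>(fst ` \<A>)" "finite_seqs \<subseteq> \<Union>(snd ` \<A>)"
    using ne d(1,2) by fast+
  moreover have "\<Union>(fst ` \<A>) \<subseteq> null_seqs" "\<Union>(snd ` \<A>) \<subseteq> null_seqs"
    using d(3,4) by (simp_all add: UN_least)
  ultimately show ?thesis unfolding dual_pair_def using p q o by (intro conjI ballI)
qed

text \<open>Stage \<open>i\<close> serves the matrix \<open>c i\<close> and also the single sequence
  \<open>c i 0\<close>; thanks to constant matrices one enumeration reaches every sequence as well.
  Each stage enlarges \<open>G\<close> properly, so uncountably many stages make the union
  uncountable.\<close>

lemma exists_reflexive_pair:
  fixes r :: "'i rel" and c :: "'i \<Rightarrow> nat \<Rightarrow> nat \<Rightarrow> 'a"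
  assumes p: "p \<noteq> 0" "\<not> p dvd 1" and cR: "countable (UNIV :: 'a set)"
    and r: "Well_order r" "\<And>i. i \<in> Field r \<Longrightarrow> countable (underS r i)" "\<not> countable (Field r)"
    and c: "\<And>C. \<exists>i\<in>Field r. c i = C"
  shows "\<exists>G H. dual_pair G H \<and> \<not> countable G \<and> (\<forall>f. covered f G H) \<and> (\<forall>f. covered f H G) \<and>
    (\<forall>C. treated C G H)"
proof -
  define P where "P s \<longleftrightarrow> dual_pair (fst s) (snd s) \<and> countable (fst s) \<and> countable (snd s)"
    for s :: "(nat \<Rightarrow> 'a) set \<times> (nat \<Rightarrow> 'a) set"
  define D where "D i s t \<longleftrightarrow> covered (c i 0) (fst t) (snd t) \<and> covered (c i 0) (snd t) (fst t) \<and>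
    treated (c i) (fst t) (snd t) \<and> fst s \<subset> fst t"
    for i and s t :: "(nat \<Rightarrow> 'a) set \<times> (nat \<Rightarrow> 'a) set"
  have "\<exists>Z U. \<forall>i\<in>Field r. P (Z i) \<and> P (U i) \<and> U i \<le> Z i \<and> D i (U i) (Z i) \<and>
    (\<forall>j\<in>underS r i. Z j \<le> U i)"
  proof (rule transfinite_chain[where P = P and D = D and ?s0.0 = "(finite_seqs, finite_seqs)", OF r(1,2)])
    show "P (finite_seqs, finite_seqs)"
      unfolding P_def fst_conv snd_conv using dual_pair_finite_seqs countable_finite_seqs[OF cR] by blast
  next
    fix i s assume "i \<in> Field r" and Ps: "P s"
    then have s: "dual_pair (fst s) (snd s)" "countable (fst s)" "countable (snd s)"
      unfolding P_def by blast+
    obtain G1 where 1: "fst s \<subset> G1" "dual_pair G1 (snd s)" "countable G1"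
      using extend_proper[OF p cR s] by (elim exE conjE)
    obtain G2 where 2: "G1 \<subseteq> G2" "dual_pair G2 (snd s)" "countable G2" "covered (c i 0) G2 (snd s)"
      using extend_covered[OF p cR 1(2,3) s(3), of "c i 0"] by (elim exE conjE)
    obtain H2 where 3: "snd s \<subseteq> H2" "dual_pair H2 G2" "countable H2" "covered (c i 0) H2 G2"
      using extend_covered[OF p cR dual_pair_swap[OF 2(2)] s(3) 2(3), of "c i 0"] by (elim exE conjE)
    obtain G3 H3 where 4: "G2 \<subseteq> G3" "H2 \<subseteq> H3" "dual_pair G3 H3" "countable G3" "countable H3"
        "treated (c i) G3 H3"
      using extend_treated[OF p cR dual_pair_swap[OF 3(2)] 2(3) 3(3), of "c i"] by (elim exE conjE)
    have sub: "snd s \<subseteq> H3" using 3(1) 4(2) by (rule order_trans)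
    have "s \<le> (G3, H3)"
      unfolding less_eq_prod_def fst_conv snd_conv using 1(1) 2(1) 4(1) sub by blast
    moreover have "P (G3, H3)" unfolding P_def fst_conv snd_conv using 4(3-5) by blast
    moreover have "D i s (G3, H3)"
      unfolding D_def fst_conv snd_conv
      using covered_mono[OF 2(4) 4(1) sub] covered_mono[OF 3(4) 4(2) 4(1)] 4(6) 1(1) 2(1) 4(1)
      by blast
    ultimately show "\<exists>t. s \<le> t \<and> P t \<and> D i s t" by blast
  next
    fix A :: "((nat \<Rightarrow> 'a) set \<times> (nat \<Rightarrow> 'a) set) set"
    assume A: "countable A" "A \<noteq> {}" "\<forall>s\<in>A. P s" "\<forall>s\<in>A. \<forall>t\<in>A. s \<le> t \<or> t \<le> s"
    have "dual_pair (\<Union>(fst ` A)) (\<Union>(snd ` A))"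
    proof (rule dual_pair_Union[OF A(2)])
      show "dual_pair (fst s) (snd s)" if "s \<in> A" for s using A(3) that unfolding P_def by blast
    qed (rule A(4)[rule_format])
    moreover have "countable (\<Union>(fst ` A))" "countable (\<Union>(snd ` A))"
      using A(1,3) unfolding P_def by (intro countable_UN; blast)+
    ultimately show "P (Sup A)" unfolding P_def Sup_prod_def fst_conv snd_conv by blast
  qed
  then obtain Z U where ZU: "\<forall>i\<in>Field r. P (Z i) \<and> P (U i) \<and> U i \<le> Z i \<and> D i (U i) (Z i) \<and>
    (\<forall>j\<in>underS r i. Z j \<le> U i)" by (elim exE)
  have Z: "P (Z i)" "U i \<le> Z i" "D i (U i) (Z i)" "j \<in> underS r i \<Longrightarrow> Z j \<le> U i"
    if "i \<in> Field r" for i j using ZU that by blast+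
  interpret r: wo_rel r using r(1) by (simp add: wo_rel_def)
  have total: "i = j \<or> i \<in> underS r j \<or> j \<in> underS r i" if "i \<in> Field r" "j \<in> Field r" for i j
    using r.TOTAL that unfolding total_on_def underS_def by auto
  define G H where "G = \<Union>(fst ` Z ` Field r)" and "H = \<Union>(snd ` Z ` Field r)"
  have sub: "fst (Z i) \<subseteq> G" "snd (Z i) \<subseteq> H" if "i \<in> Field r" for i
    unfolding G_def H_def using that by blast+
  have "dual_pair G H"
    unfolding G_def H_def
  proof (rule dual_pair_Union)
    show "Z ` Field r \<noteq> {}" using c by blast
    show "dual_pair (fst s) (snd s)" if "s \<in> Z ` Field r" for s
      using that Z(1) unfolding P_def by blast
    fix s t assume "s \<in> Z ` Field r" "t \<in> Z ` Field r"
    then obtain i j where ij: "i \<in> Field r" "j \<in> Field r" "s = Z i" "t = Z j" by blast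
    then show "s \<le> t \<or> t \<le> s"
      using total[OF ij(1,2)] Z(2)[OF ij(1)] Z(2)[OF ij(2)] Z(4)[OF ij(1)] Z(4)[OF ij(2)]
      by (metis order_refl order_trans)
  qed
  moreover have "covered f G H" "covered f H G" for f
  proof -
    obtain i where i: "i \<in> Field r" "c i = (\<lambda>_. f)" using c by blast
    then have "covered f (fst (Z i)) (snd (Z i))" "covered f (snd (Z i)) (fst (Z i))"
      using Z(3)[OF i(1)] unfolding D_def i(2) by blast+
    then show "covered f G H" "covered f H G" using covered_mono sub[OF i(1)] by blast+
  qed
  moreover have "treated C G H" for C
  proof -
    obtain i where i: "i \<in> Field r" "c i = C" using c by blast
    then have "treated C (fst (Z i)) (snd (Z i))" using Z(3)[OF i(1)] unfolding D_def by blast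
    then show ?thesis using treated_mono sub[OF i(1)] by blast
  qed
  moreover have "\<not> countable G"
  proof
    assume G: "countable G"
    have "\<exists>x. x \<in> fst (Z i) \<and> x \<notin> fst (U i)" if "i \<in> Field r" for i
      using Z(3)[OF that] unfolding D_def by blast
    then obtain x where x: "\<And>i. i \<in> Field r \<Longrightarrow> x i \<in> fst (Z i) \<and> x i \<notin> fst (U i)" by metis
    have ne: "x i \<noteq> x j" if "i \<in> underS r j" "i \<in> Field r" "j \<in> Field r" for i j
    proof -
      have "fst (Z i) \<subseteq> fst (U j)" using Z(4)[OF that(3,1)] unfolding less_eq_prod_def by blast
      then show ?thesis using x[OF that(2)] x[OF that(3)] by auto
    qed
    have "inj_on x (Field r)"
    proof (rule inj_onI)
      fix i j assume "i \<in> Field r" "j \<in> Field r" "x i = x j"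
      then show "i = j" using total ne by metis
    qed
    moreover have "countable (x ` Field r)"
      using G by (rule countable_subset[rotated]) (use x sub in blast)
    ultimately have "countable (Field r)" by (rule countable_image_inj_on[rotated])
    then show False using r(3) by blast
  qed
  ultimately show ?thesis by blast
qed

section \<open>Linear functionals on one side of a dual pair\<close>

definition linear_on :: "(nat \<Rightarrow> 'a) set \<Rightarrow> ((nat \<Rightarrow> 'a) \<Rightarrow> 'a) \<Rightarrow> bool" where
  "linear_on G F \<longleftrightarrow> (\<forall>x\<in>G. \<forall>y\<in>G. F (\<lambda>i. x i + y i) = F x + F y) \<and>
     (\<forall>r. \<forall>x\<in>G. F (\<lambda>i. r * x i) = r * F x)"

lemma linear_on_add: "linear_on G F \<Longrightarrow> x \<in> G \<Longrightarrow> y \<in> G \<Longrightarrow> F (\<lambda>i. x i + y i) = F x + F y"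
  and linear_on_scale: "linear_on G F \<Longrightarrow> x \<in> G \<Longrightarrow> F (\<lambda>i. r * x i) = r * F x"
  unfolding linear_on_def by simp_all

text \<open>From \<open>N\<close> on, the tail of \<open>x\<close> is divisible by \<open>m\<close>,
  and by purity the quotient \<open>y\<close> is again in \<open>G\<close>. Hence \<open>F x\<close>
  and the value of \<open>F\<close> on the head agree modulo \<open>m\<close>: every functional is
  automatically continuous.\<close>

lemma functional_pairing:
  assumes G: "pure G" "finite_seqs \<subseteq> G" "G \<subseteq> null_seqs" and F: "linear_on G F" and x: "x \<in> G"
  shows "pairing (\<lambda>i. F (unit_seq i)) x (F x)"
  unfolding pairing_def
proof (intro allI impI)
  fix m assume m: "m \<noteq> (0::'a)"
  have "\<forall>\<^sub>F i in sequentially. m dvd x i" using x G(3) m unfolding null_seqs_def by blast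
  then obtain N where N: "\<And>i. i \<ge> N \<Longrightarrow> m dvd x i" unfolding eventually_sequentially by blast
  define hd where "hd n = (\<lambda>i. if i < n then x i else 0)" for n :: nat
  have hd_fin: "hd n \<in> finite_seqs" for n
    unfolding finite_seqs_def hd_def by (auto intro!: exI[of _ n])
  have hd_G: "hd n \<in> G" for n using hd_fin G(2) by blast
  have unit_G: "unit_seq n \<in> G" for n using unit_seq_finite G(2) by blast
  have F_hd: "F (hd n) = (\<Sum>i<n. F (unit_seq i) * x i)" for n
  proof (induction n)
    case 0
    have "hd 0 = (\<lambda>i. 0 * unit_seq 0 i)" by (auto simp: hd_def)
    then have "F (hd 0) = 0 * F (unit_seq 0)"
      using linear_on_scale[OF F unit_G[of 0], of 0] by (simp only:)
    then show ?case by simp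
  next
    case (Suc n)
    have "hd (Suc n) = (\<lambda>i. hd n i + x n * unit_seq n i)"
      by (auto simp: hd_def unit_seq_def less_Suc_eq)
    then have "F (hd (Suc n)) = F (hd n) + F (\<lambda>i. x n * unit_seq n i)"
      using linear_on_add[OF F hd_G[of n] pure_scale[OF G(1) unit_G[of n], of "x n"]]
      by (simp only:)
    also have "F (\<lambda>i. x n * unit_seq n i) = x n * F (unit_seq n)"
      by (rule linear_on_scale[OF F unit_G])
    finally show ?case using Suc.IH by (simp add: mult.commute)
  qed
  have "m dvd (\<Sum>i<n. F (unit_seq i) * x i) - F x" if "n \<ge> N" for n
  proof -
    have "\<exists>d. x i - hd n i = m * d" for i
    proof (cases "i < n")
      case True
      then have "x i - hd n i = m * 0" by (simp add: hd_def)
      then show ?thesis by blast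
    next
      case False
      then have "m dvd x i - hd n i" using N[of i] that by (simp add: hd_def)
      then show ?thesis unfolding dvd_def .
    qed
    then have "\<forall>i. \<exists>d. x i - hd n i = m * d" by blast
    from choice[OF this] obtain y where y: "\<forall>i. x i - hd n i = m * y i" by blast
    have "(\<lambda>i. m * y i) = (\<lambda>i. x i - hd n i)" using y by simp
    then have "(\<lambda>i. m * y i) \<in> G" using pure_diff[OF G(1) x hd_G[of n]] by (simp only:)
    with pure_cancel[OF G(1) m] have yG: "y \<in> G" by blast
    have "x = (\<lambda>i. hd n i + m * y i)"
    proof
      fix i
      have "hd n i + m * y i = hd n i + (x i - hd n i)" using y by simp
      also have "\<dots> = x i" by (simp add: algebra_simps)
      finally show "x i = hd n i + m * y i" ..
    qed
    then have "F x = F (\<lambda>i. hd n i + m * y i)" by (rule arg_cong)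
    also have "\<dots> = F (hd n) + F (\<lambda>i. m * y i)"
      by (rule linear_on_add[OF F hd_G pure_scale[OF G(1) yG]])
    also have "F (\<lambda>i. m * y i) = m * F y" by (rule linear_on_scale[OF F yG])
    finally have "(\<Sum>i<n. F (unit_seq i) * x i) - F x = m * (- F y)"
      unfolding F_hd by (simp add: algebra_simps)
    then show ?thesis by simp
  qed
  then show "\<forall>\<^sub>F n in sequentially. m dvd (\<Sum>i<n. F (unit_seq i) * x i) - F x"
    unfolding eventually_sequentially by blast
qed

text \<open>The values of \<open>F\<close> on the unit vectors form a sequence that has a product
  with every element of \<open>G\<close>, and \<open>covered\<close> then puts it into
  \<open>H\<close>.\<close>

lemma functional_represented:
  assumes "dual_pair G H" "\<And>f. covered f G H" "linear_on G F"
  shows "\<exists>h\<in>H. \<forall>x\<in>G. pairing h x (F x)"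
proof -
  have G: "pure G" "finite_seqs \<subseteq> G" "G \<subseteq> null_seqs"
    using assms(1) unfolding dual_pair_def by simp_all
  have pr: "pairing (\<lambda>i. F (unit_seq i)) x (F x)" if "x \<in> G" for x
    using functional_pairing[OF G assms(3) that] .
  then have "(\<lambda>i. F (unit_seq i)) \<in> H"
    using assms(2)[of "\<lambda>i. F (unit_seq i)"] unfolding covered_def orth_def by auto
  then show ?thesis using pr by (intro bexI[of _ "\<lambda>i. F (unit_seq i)"]) auto
qed

section \<open>Injective endomorphisms and their cokernels\<close>

text \<open>Through \<open>fspan_least\<close>, what pairs to zero with \<open>gs\<close> pairs to
  zero with all of \<open>fspan gs\<close>.\<close>

lemma pure_annihilator: "pure {h. pairing h x 0}"
  unfolding pure_def mem_Collect_eq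
proof (intro conjI ballI allI impI)
  show "pairing (\<lambda>_. 0) x 0" by (rule pairing_zero)
next
  fix f g assume "f \<in> {h. pairing h x 0}" "g \<in> {h. pairing h x 0}"
  then show "pairing (\<lambda>i. f i + g i) x 0" using pairing_add[of f x 0 g 0] by simp
next
  fix r f assume "f \<in> {h. pairing h x 0}"
  then show "pairing (\<lambda>i. r * f i) x 0" using pairing_scale[of f x 0 r] by simp
next
  fix s f assume s: "s \<noteq> 0" "pairing (\<lambda>i. s * f i) x 0"
  from pairing_cancel[OF s] obtain d where d: "0 = s * d" "pairing f x d" .
  have "d = 0" using d(1) s(1) by (metis mult_eq_0_iff)
  with d(2) show "pairing f x 0" by simp
qed

text \<open>For linear \<open>\<phi>\<close> this is the polynomial in \<open>\<phi>\<close> with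
  coefficient list \<open>as\<close>, constant term first, applied to \<open>e\<close>. The nested
  form exhibits it as a multiple of \<open>e\<close> plus a value of \<open>\<phi>\<close>.\<close>

primrec horner :: "((nat \<Rightarrow> 'a) \<Rightarrow> nat \<Rightarrow> 'a) \<Rightarrow> (nat \<Rightarrow> 'a) \<Rightarrow> 'a list \<Rightarrow> nat \<Rightarrow> 'a" where
  "horner \<phi> e [] = (\<lambda>_. 0)"
| "horner \<phi> e (a # as) = (\<lambda>i. a * e i + \<phi> (horner \<phi> e as) i)"

text \<open>
  Here \<open>s \<phi> = r\<close> on a submodule \<open>N\<close> of finite corank. If \<open>r \<noteq> 0\<close>, injectivity of \<open>\<phi>\<close> passes to the
  quotient by \<open>N\<close>, so a nontrivial relation between \<open>e, \<phi> e, \<phi>\<^sup>2 e, \<dots>\<close> modulo \<open>N\<close> can be divided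
  by \<open>\<phi>\<close> until it puts a nonzero multiple of \<open>e\<close> into the image of \<open>\<phi>\<close>.
\<close>

lemma no_complement:
  assumes p: "p \<noteq> 0" "\<not> p dvd 1"
    and GH: "dual_pair G H" and tr: "\<And>C. treated C G H"
    and \<phi>G: "\<And>x. x \<in> G \<Longrightarrow> \<phi> x \<in> G"
    and add: "\<And>x y. x \<in> G \<Longrightarrow> y \<in> G \<Longrightarrow> \<phi> (\<lambda>i. x i + y i) = (\<lambda>i. \<phi> x i + \<phi> y i)"
    and scale: "\<And>r x. x \<in> G \<Longrightarrow> \<phi> (\<lambda>i. r * x i) = (\<lambda>i. r * \<phi> x i)"
    and inj: "inj_on \<phi> G" and e: "e \<in> G"
    and disj: "\<And>a w. w \<in> G \<Longrightarrow> \<phi> w = (\<lambda>i. a * e i) \<Longrightarrow> a = 0"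
  shows False
proof -
  have G: "pure G" "finite_seqs \<subseteq> G" "G \<subseteq> null_seqs" and oGH: "\<And>g h. g \<in> G \<Longrightarrow> h \<in> H \<Longrightarrow> orth g h"
    using GH unfolding dual_pair_def by simp_all
  \<comment> \<open>\<open>C k\<close> represents the functional that takes \<open>x\<close> to
    coordinate \<open>k\<close> of \<open>\<phi> x\<close>.\<close>
  define C where "C k i = \<phi> (unit_seq i) k" for k i
  have lin: "linear_on G (\<lambda>x. \<phi> x k)" for k
    unfolding linear_on_def by (simp add: add scale)
  have C: "pairing (C k) x (\<phi> x k)" if "x \<in> G" for x k
    unfolding C_def using functional_pairing[OF G lin that, of k] .
  \<comment> \<open>The first two alternatives of \<open>treated\<close> are impossible because
    \<open>C\<close> computes \<open>\<phi> x\<close>, which lies in \<open>G\<close>.\<close>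
  from tr[of C] have "\<exists>s r gs. s \<noteq> 0 \<and> set gs \<subseteq> H \<and>
      (\<forall>k. (\<lambda>i. s * C k i - r * unit_seq k i) \<in> fspan gs)"
    unfolding treated_def
  proof (elim disjE)
    assume "\<exists>k. \<exists>x\<in>G. \<not> orth (C k) x"
    then obtain k x where "x \<in> G" "\<not> orth (C k) x" by blast
    with C have False unfolding orth_def by blast
    then show ?thesis ..
  next
    assume "\<exists>x\<in>G. \<exists>y. \<exists>h\<in>H. (\<forall>k. pairing (C k) x (y k)) \<and> \<not> orth y h"
    then obtain x y h where x: "x \<in> G" "h \<in> H" "\<forall>k. pairing (C k) x (y k)" "\<not> orth y h" by blast
    have "y = \<phi> x"
    proof
      fix k show "y k = \<phi> x k" by (rule pairing_unique[OF p x(3)[rule_format] C[OF x(1)]])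
    qed
    then have False using x oGH \<phi>G by simp
    then show ?thesis ..
  qed
  then obtain s r gs where s: "s \<noteq> 0" and gs: "set gs \<subseteq> H"
    and A: "\<And>k. (\<lambda>i. s * C k i - r * unit_seq k i) \<in> fspan gs" by blast
  \<comment> \<open>\<open>N\<close> has finite corank in \<open>G\<close>, and
    \<open>s \<phi> = r\<close> on it because the sequences \<open>s C k - r e\<close> with
    \<open>e = unit_seq k\<close> lie in \<open>fspan gs\<close>.\<close>
  define N where "N = {x \<in> G. \<forall>g\<in>set gs. pairing g x 0}"
  have N: "s * \<phi> x k = r * x k" if "x \<in> N" for x k
  proof -
    have xG: "x \<in> G" and "set gs \<subseteq> {h. pairing h x 0}" using that unfolding N_def by auto
    then have "fspan gs \<subseteq> {h. pairing h x 0}" by (intro fspan_least pure_annihilator)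
    then have "pairing (\<lambda>i. s * C k i - r * unit_seq k i) x 0" using A by blast
    moreover have "pairing (\<lambda>i. s * C k i - r * unit_seq k i) x (s * \<phi> x k - r * x k)"
      by (intro pairing_diff pairing_scale C xG pairing_unit_left)
    ultimately have "s * \<phi> x k - r * x k = 0" by (rule pairing_unique[OF p, rotated])
    then show ?thesis by (simp only: right_minus_eq)
  qed
  have zeroG: "(\<lambda>_. 0) \<in> G" using G(1) by (rule pure_zero)
  have \<phi>0: "\<phi> (\<lambda>_. 0) = (\<lambda>_. 0)" using scale[OF zeroG, of 0] by simp
  show False
  proof (cases "r = 0")
    case True
    \<comment> \<open>If \<open>r = 0\<close>, then \<open>\<phi>\<close> kills \<open>N\<close>,
      which contains a nonzero element.\<close>
    obtain u where u: "u \<in> finite_seqs" "\<forall>g\<in>set gs. fpair g u = 0" "\<exists>i. u i \<noteq> 0"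
      using ex_annihilator by blast
    have uG: "u \<in> G" using u(1) G(2) by blast
    have "pairing g u 0" if "g \<in> set gs" for g using pairing_finite[OF u(1), of g] u(2) that by simp
    then have "u \<in> N" using uG unfolding N_def by blast
    then have "s * \<phi> u k = 0" for k using N[of u k] True by simp
    then have "\<phi> u = (\<lambda>_. 0)" using s by auto
    then have "\<phi> u = \<phi> (\<lambda>_. 0)" unfolding \<phi>0 .
    then have "u = (\<lambda>_. 0)" by (rule inj_onD[OF inj _ uG zeroG])
    with u(3) show False by simp
  next
    case r: False
    \<comment> \<open>Injectivity turns \<open>s \<phi> (\<phi> v) = r \<phi> v\<close> into
      \<open>s \<phi> v = r v\<close>. Since \<open>\<phi> v\<close> pairs to zero with
      \<open>gs\<close> and \<open>r\<close> is nonzero, so does \<open>v\<close>.\<close>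
    have descend: "v \<in> N" if v: "v \<in> G" "\<phi> v \<in> N" for v
    proof -
      have "\<phi> (\<lambda>i. s * \<phi> v i) = \<phi> (\<lambda>i. r * v i)"
        unfolding scale[OF \<phi>G[OF v(1)]] scale[OF v(1)] using N[OF v(2)] by simp
      then have eq: "(\<lambda>i. s * \<phi> v i) = (\<lambda>i. r * v i)"
        by (rule inj_onD[OF inj]) (intro pure_scale[OF G(1)] \<phi>G v(1))+
      have "pairing g v 0" if "g \<in> set gs" for g
      proof -
        have "pairing (\<phi> v) g 0" using v(2) that unfolding N_def by (auto simp: pairing_commute)
        then have "pairing (\<lambda>i. s * \<phi> v i) g 0" using pairing_scale[of "\<phi> v" g 0 s] by simp
        then have "pairing (\<lambda>i. r * v i) g 0" unfolding eq .
        from pairing_cancel[OF r this] obtain d where d: "0 = r * d" "pairing v g d" .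
        have "d = 0" using d(1) r by (metis mult_eq_0_iff)
        with d(2) show ?thesis by (simp add: pairing_commute)
      qed
      then show ?thesis using v(1) unfolding N_def by blast
    qed
    have hG: "horner \<phi> f as \<in> G" if "f \<in> G" for f as
    proof (induction as)
      case (Cons a as)
      then show ?case using pure_add[OF G(1) pure_scale[OF G(1) that] \<phi>G] by simp
    qed (simp add: zeroG)
    \<comment> \<open>If \<open>z = a e + \<phi> w\<close> is in \<open>N\<close>, then
      \<open>\<phi> (s z - r w) = r z - r \<phi> w = r a e\<close>, and \<open>disj\<close> yields
      \<open>a = 0\<close>. Now \<open>z = \<phi> w\<close>, and \<open>descend\<close> passes to
      the shorter list.\<close>
    have coeffs: "\<forall>a\<in>set as. a = 0" if "horner \<phi> e as \<in> N" for as
      using that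
    proof (induction as)
      case (Cons a as)
      define z w where "z = horner \<phi> e (a # as)" and "w = horner \<phi> e as"
      have zw: "z = (\<lambda>i. a * e i + \<phi> w i)" unfolding z_def w_def by simp
      have zG: "z \<in> G" and wG: "w \<in> G" unfolding z_def w_def using hG[OF e] by blast+
      have zN: "z \<in> N" using Cons.prems unfolding z_def .
      have "\<phi> (\<lambda>i. s * z i + (- r) * w i) = (\<lambda>i. s * \<phi> z i + (- r) * \<phi> w i)"
        unfolding add[OF pure_scale[OF G(1) zG] pure_scale[OF G(1) wG]] scale[OF zG] scale[OF wG] ..
      also have "\<dots> = (\<lambda>i. (r * a) * e i)"
      proof
        fix i
        have "s * \<phi> z i + (- r) * \<phi> w i = r * z i - r * \<phi> w i" unfolding N[OF zN] by simp
        also have "\<dots> = (r * a) * e i" unfolding zw by (simp add: algebra_simps)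
        finally show "s * \<phi> z i + (- r) * \<phi> w i = (r * a) * e i" .
      qed
      finally have "r * a = 0" by (rule disj[OF pure_lincomb[OF G(1) zG wG]])
      then have a: "a = 0" using r by simp
      then have "z = \<phi> w" unfolding zw by simp
      then have "w \<in> N" using descend[OF wG] zN by simp
      then show ?case using Cons.IH a unfolding w_def by simp
    qed simp
    have shift: "\<phi> (horner \<phi> f as) = horner \<phi> (\<phi> f) as" if "f \<in> G" for f as
    proof (induction as)
      case (Cons a as)
      have "\<phi> (horner \<phi> f (a # as)) = (\<lambda>i. a * \<phi> f i + \<phi> (\<phi> (horner \<phi> f as)) i)"
        unfolding horner.simps
          add[OF pure_scale[OF G(1) that] \<phi>G[OF hG[OF that]]] scale[OF that] ..
      then show ?case using Cons by simp
    qed (simp add: \<phi>0)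
    \<comment> \<open>The pairing with \<open>g\<close> is linear in the coefficients, so membership
      in \<open>N\<close> becomes finitely many linear conditions on them.\<close>
    have hp: "pairing g (horner \<phi> f as) (\<Sum>j<length as. as ! j * d j)"
      if "f \<in> G" "\<And>j. pairing g ((\<phi> ^^ j) f) (d j)" for g f as d
      using that
    proof (induction as arbitrary: f d)
      case Nil
      show ?case using pairing_zero[of g] by (simp add: pairing_commute)
    next
      case (Cons a as)
      have 1: "pairing (horner \<phi> (\<phi> f) as) g (\<Sum>j<length as. as ! j * d (Suc j))"
      proof (subst pairing_commute, rule Cons.IH)
        show "\<phi> f \<in> G" using Cons.prems(1) by (rule \<phi>G)
        show "pairing g ((\<phi> ^^ j) (\<phi> f)) (d (Suc j))" for j
          using Cons.prems(2)[of "Suc j"] by (simp add: funpow_swap1)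
      qed
      have 2: "pairing f g (d 0)" using Cons.prems(2)[of 0] by (simp add: pairing_commute)
      have "pairing (\<lambda>i. a * f i + horner \<phi> (\<phi> f) as i) g
          (a * d 0 + (\<Sum>j<length as. as ! j * d (Suc j)))"
        using pairing_scale[OF 2] 1 by (rule pairing_add)
      also have "a * d 0 + (\<Sum>j<length as. as ! j * d (Suc j)) =
          (\<Sum>j<length (a # as). (a # as) ! j * d j)"
        unfolding list.size(4) add_0_right add_Suc_right sum.lessThan_Suc_shift by simp
      finally show ?case
        using shift[OF Cons.prems(1)] by (simp add: pairing_commute)
    qed
    have pow_G: "(\<phi> ^^ j) e \<in> G" for j by (induction j) (simp_all add: e \<phi>G)
    have "\<forall>g\<in>set gs. \<exists>d. \<forall>j. pairing g ((\<phi> ^^ j) e) (d j)"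
    proof
      fix g assume "g \<in> set gs"
      then have "orth ((\<phi> ^^ j) e) g" for j using oGH[OF pow_G] gs by blast
      then have "\<forall>j. \<exists>c. pairing g ((\<phi> ^^ j) e) c" using orth_commute unfolding orth_def by blast
      then show "\<exists>d. \<forall>j. pairing g ((\<phi> ^^ j) e) (d j)" by (rule choice)
    qed
    from bchoice[OF this] obtain d where d: "\<forall>g\<in>set gs. \<forall>j. pairing g ((\<phi> ^^ j) e) (d g j)"
      by blast
    \<comment> \<open>Here \<open>ex_annihilator\<close> is applied to the sequences of pairing
      values \<open>d g\<close>, and \<open>u\<close> supplies polynomial coefficients that are not
      all zero.\<close>
    obtain u where u: "u \<in> finite_seqs" "\<forall>g\<in>set (map d gs). fpair g u = 0" "\<exists>i. u i \<noteq> 0"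
      using ex_annihilator by blast
    then obtain M where M: "\<forall>i\<ge>M. u i = 0" unfolding finite_seqs_def by blast
    define as where "as = map u [0..<M]"
    have "pairing g (horner \<phi> e as) 0" if "g \<in> set gs" for g
    proof -
      have "pairing g (horner \<phi> e as) (\<Sum>j<length as. as ! j * d g j)"
        using d that by (intro hp[OF e]) blast
      also have "(\<Sum>j<length as. as ! j * d g j) = (\<Sum>j<M. d g j * u j)"
        unfolding as_def by (simp add: mult.commute)
      also have "\<dots> = fpair (d g) u" using fpair_eq[OF M] by simp
      also have "\<dots> = 0" using u(2) that by simp
      finally show ?thesis .
    qed
    then have "horner \<phi> e as \<in> N" using hG[OF e] unfolding N_def by blast
    then have "\<forall>a\<in>set as. a = 0" by (rule coeffs)
    then have "u i = 0" if "i < M" for i using that unfolding as_def by simp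
    then have "u i = 0" for i using M by (cases "i < M") auto
    then show False using u(3) by blast
  qed
qed

end

section \<open>Transfer to modules over a ring with carrier\<close>

text \<open>The graph of \<open>f\<close> as a set of numbers, which places the elements of the
  module in the type \<open>nat set\<close>.\<close>

definition seq_code :: "(nat \<Rightarrow> nat) \<Rightarrow> nat set" where
  "seq_code f = range (\<lambda>i. prod_encode (i, f i))"

definition seq_decode :: "nat set \<Rightarrow> nat \<Rightarrow> nat" where
  "seq_decode = inv_into UNIV seq_code"

lemma inj_seq_code: "inj seq_code"
proof (rule injI, rule ext)
  fix f g :: "nat \<Rightarrow> nat" and i assume "seq_code f = seq_code g"
  then have "prod_encode (i, f i) \<in> seq_code g" unfolding seq_code_def by blast
  then show "f i = g i" unfolding seq_code_def by auto
qed

lemma seq_decode_code [simp]: "seq_decode (seq_code f) = f"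
  unfolding seq_decode_def using inj_seq_code by (rule inv_f_f)

text \<open>The theory above has its operations on a whole type, whereas \<open>R\<close> has a
  carrier. A bijection of the carrier with the natural numbers transports the ring to the type
  \<open>nat\<close>.\<close>

locale coded_domain = domain R for R :: "('a, 'r) ring_scheme" (structure) +
  fixes \<pi> :: "nat \<Rightarrow> 'a" and \<rho> :: "'a \<Rightarrow> nat"
  assumes \<pi>_closed [simp]: "\<pi> n \<in> carrier R"
    and \<rho>_\<pi> [simp]: "\<rho> (\<pi> n) = n"
    and \<pi>_\<rho> [simp]: "a \<in> carrier R \<Longrightarrow> \<pi> (\<rho> a) = a"
begin

definition "code_plus m n = \<rho> (\<pi> m \<oplus> \<pi> n)"
definition "code_times m n = \<rho> (\<pi> m \<otimes> \<pi> n)"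
definition "code_minus m n = \<rho> (\<pi> m \<ominus> \<pi> n)"
definition "code_uminus m = \<rho> (\<ominus> \<pi> m)"
definition "code_zero = \<rho> \<zero>"
definition "code_one = \<rho> \<one>"

lemma \<pi>_ops [simp]:
  "\<pi> (code_plus m n) = \<pi> m \<oplus> \<pi> n" "\<pi> (code_times m n) = \<pi> m \<otimes> \<pi> n"
  "\<pi> (code_minus m n) = \<pi> m \<ominus> \<pi> n" "\<pi> (code_uminus m) = \<ominus> \<pi> m" "\<pi> code_zero = \<zero>" "\<pi> code_one = \<one>"
  by (simp_all add: code_plus_def code_times_def code_minus_def code_uminus_def code_zero_def code_one_def)

lemma code_eq_iff: "m = n \<longleftrightarrow> \<pi> m = \<pi> n"
  by (metis \<rho>_\<pi>)

lemma \<rho>_ops: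
  "a \<in> carrier R \<Longrightarrow> b \<in> carrier R \<Longrightarrow> \<rho> (a \<oplus> b) = code_plus (\<rho> a) (\<rho> b)"
  "a \<in> carrier R \<Longrightarrow> b \<in> carrier R \<Longrightarrow> \<rho> (a \<otimes> b) = code_times (\<rho> a) (\<rho> b)"
  by (simp_all add: code_eq_iff)

sublocale N: idom code_times code_one code_plus code_zero code_minus code_uminus
  apply unfold_locales
  apply (simp_all only: code_eq_iff \<pi>_ops)
  apply (simp_all add: a_assoc m_assoc l_distr minus_eq l_neg integral_iff)
  apply (simp_all add: r_distr a_comm m_comm)
  done

text \<open>Scalars stay in \<open>R\<close> and act through their codes; \<open>mult\<close> and
  \<open>one\<close> are dummies.\<close>

definition coded_module :: "(nat \<Rightarrow> nat) set \<Rightarrow> ('a, nat set) module" where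
  "coded_module G =
     \<lparr>carrier = seq_code ` G,
      mult = (\<lambda>_ _. seq_code (\<lambda>_. code_zero)),
      one = seq_code (\<lambda>_. code_zero),
      zero = seq_code (\<lambda>_. code_zero),
      add = (\<lambda>x y. seq_code (\<lambda>i. code_plus (seq_decode x i) (seq_decode y i))),
      smult = (\<lambda>a x. seq_code (\<lambda>i. code_times (\<rho> a) (seq_decode x i)))\<rparr>"

lemma coded_module_simps [simp]:
  "carrier (coded_module G) = seq_code ` G"
  "\<zero>\<^bsub>coded_module G\<^esub> = seq_code (\<lambda>_. code_zero)"
  "seq_code f \<oplus>\<^bsub>coded_module G\<^esub> seq_code g = seq_code (\<lambda>i. code_plus (f i) (g i))"
  "a \<odot>\<^bsub>coded_module G\<^esub> seq_code f = seq_code (\<lambda>i. code_times (\<rho> a) (f i))"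
  by (simp_all add: coded_module_def)

lemma module_coded_module:
  assumes G: "N.pure G"
  shows "Module.module R (coded_module G)"
proof (rule moduleI)
  show "cring R" by (rule is_cring)
  show "abelian_group (coded_module G)"
  proof (rule abelian_groupI)
    fix x assume "x \<in> carrier (coded_module G)"
    then obtain f where f: "f \<in> G" "x = seq_code f" by auto
    have "(\<lambda>i. code_times (code_uminus code_one) (f i)) \<in> G" using G f(1) by (rule N.pure_scale)
    moreover have "seq_code (\<lambda>i. code_times (code_uminus code_one) (f i)) \<oplus>\<^bsub>coded_module G\<^esub> x =
        \<zero>\<^bsub>coded_module G\<^esub>"
      unfolding f(2) coded_module_simps N.mult_minus1 N.ab_left_minus ..
    ultimately show "\<exists>y\<in>carrier (coded_module G). y \<oplus>\<^bsub>coded_module G\<^esub> x = \<zero>\<^bsub>coded_module G\<^esub>"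
      unfolding coded_module_simps(1)
      by (intro bexI[of _ "seq_code (\<lambda>i. code_times (code_uminus code_one) (f i))"] imageI)
  qed (use N.pure_add[OF G] N.pure_zero[OF G] in \<open>auto simp: N.add.assoc N.add.commute N.add.left_commute\<close>)
next
  fix a x assume a: "a \<in> carrier R" and "x \<in> carrier (coded_module G)"
  then obtain f where f: "f \<in> G" "x = seq_code f" by auto
  show "a \<odot>\<^bsub>coded_module G\<^esub> x \<in> carrier (coded_module G)"
    unfolding f(2) using N.pure_scale[OF G f(1)] by simp
next
  fix a b x assume "a \<in> carrier R" "b \<in> carrier R" "x \<in> carrier (coded_module G)"
  then show "(a \<oplus> b) \<odot>\<^bsub>coded_module G\<^esub> x =
      a \<odot>\<^bsub>coded_module G\<^esub> x \<oplus>\<^bsub>coded_module G\<^esub> b \<odot>\<^bsub>coded_module G\<^esub> x"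
    by (auto simp: \<rho>_ops N.distrib_right)
next
  fix a x y assume "a \<in> carrier R" "x \<in> carrier (coded_module G)" "y \<in> carrier (coded_module G)"
  then show "a \<odot>\<^bsub>coded_module G\<^esub> (x \<oplus>\<^bsub>coded_module G\<^esub> y) =
      a \<odot>\<^bsub>coded_module G\<^esub> x \<oplus>\<^bsub>coded_module G\<^esub> a \<odot>\<^bsub>coded_module G\<^esub> y"
    by (auto simp: N.distrib_left)
next
  fix a b x assume "a \<in> carrier R" "b \<in> carrier R" "x \<in> carrier (coded_module G)"
  then show "a \<otimes> b \<odot>\<^bsub>coded_module G\<^esub> x =
      a \<odot>\<^bsub>coded_module G\<^esub> (b \<odot>\<^bsub>coded_module G\<^esub> x)"
    by (auto simp: \<rho>_ops N.mult.assoc)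
next
  fix x assume "x \<in> carrier (coded_module G)"
  then show "\<one> \<odot>\<^bsub>coded_module G\<^esub> x = x"
    by (auto simp: code_one_def[symmetric])
qed

end

section \<open>Duals and the evaluation map\<close>

lemma ring_as_module_simps [simp]:
  "carrier (ring_as_module R) = carrier R"
  "\<zero>\<^bsub>ring_as_module R\<^esub> = \<zero>\<^bsub>R\<^esub>"
  "a \<oplus>\<^bsub>ring_as_module R\<^esub> b = a \<oplus>\<^bsub>R\<^esub> b"
  "a \<odot>\<^bsub>ring_as_module R\<^esub> b = a \<otimes>\<^bsub>R\<^esub> b"
  by (simp_all add: ring_as_module_def)

lemma carrier_dual:
  "\<phi> \<in> carrier (dual R D) \<longleftrightarrow>
     \<phi> \<in> LinearCombinations.module_hom R D (ring_as_module R) \<and> \<phi> \<in> extensional (carrier D)"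
  by (simp add: dual_def hom_module_def)

lemma dual_ops:
  "\<phi> \<oplus>\<^bsub>dual R D\<^esub> \<psi> = (\<lambda>x\<in>carrier D. \<phi> x \<oplus>\<^bsub>R\<^esub> \<psi> x)"
  "a \<odot>\<^bsub>dual R D\<^esub> \<phi> = (\<lambda>x\<in>carrier D. a \<otimes>\<^bsub>R\<^esub> \<phi> x)"
  by (simp_all add: dual_def hom_module_def)

context cring
begin

lemma dual_closed:
  assumes D: "Module.module R D"
    and \<phi>: "\<phi> \<in> carrier (dual R D)"
  shows "\<psi> \<in> carrier (dual R D) \<Longrightarrow> \<phi> \<oplus>\<^bsub>dual R D\<^esub> \<psi> \<in> carrier (dual R D)"
    and "a \<in> carrier R \<Longrightarrow> a \<odot>\<^bsub>dual R D\<^esub> \<phi> \<in> carrier (dual R D)"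
proof -
  interpret D: Module.module R D by (rule D)
  have \<phi>c: "\<phi> x \<in> carrier R" if "x \<in> carrier D" for x
    using \<phi> that unfolding carrier_dual by (auto simp: LinearCombinations.module_hom_def)
  have \<phi>l: "\<phi> (x \<oplus>\<^bsub>D\<^esub> y) = \<phi> x \<oplus> \<phi> y" "b \<in> carrier R \<Longrightarrow> \<phi> (b \<odot>\<^bsub>D\<^esub> x) = b \<otimes> \<phi> x"
    if "x \<in> carrier D" "y \<in> carrier D" for x y b
    using \<phi> that unfolding carrier_dual by (auto simp: LinearCombinations.module_hom_def)
  {
    assume \<psi>: "\<psi> \<in> carrier (dual R D)"
    have \<psi>c: "\<psi> x \<in> carrier R" if "x \<in> carrier D" for x
      using \<psi> that unfolding carrier_dual by (auto simp: LinearCombinations.module_hom_def)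
    have \<psi>l: "\<psi> (x \<oplus>\<^bsub>D\<^esub> y) = \<psi> x \<oplus> \<psi> y" "b \<in> carrier R \<Longrightarrow> \<psi> (b \<odot>\<^bsub>D\<^esub> x) = b \<otimes> \<psi> x"
      if "x \<in> carrier D" "y \<in> carrier D" for x y b
      using \<psi> that unfolding carrier_dual by (auto simp: LinearCombinations.module_hom_def)
    show "\<phi> \<oplus>\<^bsub>dual R D\<^esub> \<psi> \<in> carrier (dual R D)"
      unfolding carrier_dual dual_ops LinearCombinations.module_hom_def
      using \<phi>c \<psi>c by (auto simp: \<phi>l \<psi>l r_distr a_ac)
  }
  assume a: "a \<in> carrier R"
  show "a \<odot>\<^bsub>dual R D\<^esub> \<phi> \<in> carrier (dual R D)"
    unfolding carrier_dual dual_ops LinearCombinations.module_hom_def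
    using \<phi>c a by (auto simp: \<phi>l r_distr m_ac)
qed

lemma evaluation_hom:
  assumes D: "Module.module R D"
  shows "evaluation R D \<in> LinearCombinations.module_hom R D (dual R (dual R D))"
proof -
  interpret D: Module.module R D by (rule D)
  note cl = dual_closed[OF D]
  have hom: "\<phi> x \<in> carrier R" "\<phi> (x \<oplus>\<^bsub>D\<^esub> y) = \<phi> x \<oplus> \<phi> y"
    "b \<in> carrier R \<Longrightarrow> \<phi> (b \<odot>\<^bsub>D\<^esub> x) = b \<otimes> \<phi> x"
    if "\<phi> \<in> carrier (dual R D)" "x \<in> carrier D" "y \<in> carrier D" for \<phi> x y b
    using that unfolding carrier_dual by (auto simp: LinearCombinations.module_hom_def)
  have ev: "evaluation R D x = (\<lambda>\<phi>\<in>carrier (dual R D). \<phi> x)" if "x \<in> carrier D" for x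
    using that by (simp add: evaluation_def)
  have "evaluation R D x \<in> carrier (dual R (dual R D))" if x: "x \<in> carrier D" for x
    unfolding ev[OF x] carrier_dual[of _ R "dual R D"] LinearCombinations.module_hom_def
    using cl hom(1) x by (auto simp: dual_ops)
  moreover have "evaluation R D (x \<oplus>\<^bsub>D\<^esub> y) = evaluation R D x \<oplus>\<^bsub>dual R (dual R D)\<^esub> evaluation R D y"
    if "x \<in> carrier D" "y \<in> carrier D" for x y
    using that unfolding dual_ops[of R "dual R D"] by (auto simp: ev hom(2) intro!: restrict_ext)
  moreover have "evaluation R D (b \<odot>\<^bsub>D\<^esub> x) = b \<odot>\<^bsub>dual R (dual R D)\<^esub> evaluation R D x"
    if "x \<in> carrier D" "b \<in> carrier R" for x b
    using that unfolding dual_ops[of R "dual R D"] by (auto simp: ev hom(3) intro!: restrict_ext)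
  ultimately show ?thesis unfolding LinearCombinations.module_hom_def by auto
qed

end

section \<open>Reflexivity of the coded module\<close>

locale coded_pair = coded_domain R \<pi> \<rho> for R :: "('a, 'r) ring_scheme" (structure) and \<pi> \<rho> +
  fixes p :: nat and G H :: "(nat \<Rightarrow> nat) set"
  assumes p: "p \<noteq> code_zero" "\<not> dvd.dvd code_times p code_one"
    and GH: "N.dual_pair G H" and cov: "N.covered f G H" "N.covered f H G" and tr: "N.treated C G H"
begin

abbreviation M :: "('a, nat set) module" where
  "M \<equiv> coded_module G"

lemma pure_GH: "N.pure G" "N.pure H"
  using GH unfolding N.dual_pair_def by simp_all

lemma units_GH: "N.unit_seq k \<in> G" "N.unit_seq k \<in> H"
  using GH N.unit_seq_finite unfolding N.dual_pair_def by blast+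

lemma module_M: "Module.module R M"
  using pure_GH(1) by (rule module_coded_module)

lemma hom_represented:
  assumes f: "f \<in> LinearCombinations.module_hom R M (ring_as_module R)"
  shows "\<exists>h\<in>H. \<forall>g\<in>G. N.pairing h g (\<rho> (f (seq_code g)))"
proof (rule N.functional_represented[OF GH cov(1)])
  have c: "f (seq_code x) \<in> carrier R" if "x \<in> G" for x
    using f that by (auto simp: LinearCombinations.module_hom_def)
  have a: "f (seq_code (\<lambda>i. code_plus (x i) (y i))) = f (seq_code x) \<oplus> f (seq_code y)"
    if "x \<in> G" "y \<in> G" for x y
    using LinearCombinations.module_hom_add[OF f, of "seq_code x" "seq_code y"] that by simp
  have s: "f (seq_code (\<lambda>i. code_times r (x i))) = \<pi> r \<otimes> f (seq_code x)" if "x \<in> G" for x r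
    using LinearCombinations.module_hom_smult[OF f, of "\<pi> r" "seq_code x"] that by simp
  show "N.linear_on G (\<lambda>g. \<rho> (f (seq_code g)))"
    unfolding N.linear_on_def using c by (simp add: a s \<rho>_ops)
qed

definition pairing_val :: "(nat \<Rightarrow> nat) \<Rightarrow> (nat \<Rightarrow> nat) \<Rightarrow> nat" where
  "pairing_val h g = (THE c. N.pairing h g c)"

lemma pairing_val_eq: "N.pairing h g c \<Longrightarrow> pairing_val h g = c"
  unfolding pairing_val_def using N.pairing_unique[OF p] by blast

lemma pairing_val: "g \<in> G \<Longrightarrow> h \<in> H \<Longrightarrow> N.pairing h g (pairing_val h g)"
proof -
  assume "g \<in> G" "h \<in> H"
  then have "N.orth h g" using GH N.orth_commute unfolding N.dual_pair_def by blast
  then obtain c where "N.pairing h g c" unfolding N.orth_def by blast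
  then show ?thesis using pairing_val_eq by metis
qed

text \<open>On \<open>H\<close> this is a map onto the dual of \<open>M\<close>; the restriction
  makes its values extensional, as the dual requires.\<close>

definition functional :: "(nat \<Rightarrow> nat) \<Rightarrow> nat set \<Rightarrow> 'a" where
  "functional h = (\<lambda>x\<in>carrier M. \<pi> (pairing_val h (seq_decode x)))"

lemma functional_code [simp]: "g \<in> G \<Longrightarrow> functional h (seq_code g) = \<pi> (pairing_val h g)"
  unfolding functional_def by simp

lemma functional_dual:
  assumes h: "h \<in> H"
  shows "functional h \<in> carrier (dual R M)"
proof -
  have "pairing_val h (\<lambda>i. code_plus (x i) (y i)) = code_plus (pairing_val h x) (pairing_val h y)"
    if "x \<in> G" "y \<in> G" for x y
  proof (rule pairing_val_eq)
    have "N.pairing x h (pairing_val h x)" "N.pairing y h (pairing_val h y)"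
      using pairing_val[OF that(1) h] pairing_val[OF that(2) h] by (simp_all add: N.pairing_commute)
    then have "N.pairing (\<lambda>i. code_plus (x i) (y i)) h (code_plus (pairing_val h x) (pairing_val h y))"
      by (rule N.pairing_add)
    then show "N.pairing h (\<lambda>i. code_plus (x i) (y i)) (code_plus (pairing_val h x) (pairing_val h y))"
      by (simp add: N.pairing_commute)
  qed
  moreover have "pairing_val h (\<lambda>i. code_times r (x i)) = code_times r (pairing_val h x)"
    if "x \<in> G" for x r
  proof (rule pairing_val_eq)
    have "N.pairing x h (pairing_val h x)"
      using pairing_val[OF that h] by (simp add: N.pairing_commute)
    then have "N.pairing (\<lambda>i. code_times r (x i)) h (code_times r (pairing_val h x))"
      by (rule N.pairing_scale)
    then show "N.pairing h (\<lambda>i. code_times r (x i)) (code_times r (pairing_val h x))"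
      by (simp add: N.pairing_commute)
  qed
  ultimately have "functional h \<in> LinearCombinations.module_hom R M (ring_as_module R)"
    unfolding LinearCombinations.module_hom_def
    using N.pure_add[OF pure_GH(1)] N.pure_scale[OF pure_GH(1)] by auto
  then show ?thesis unfolding carrier_dual functional_def by simp
qed

lemma dual_functional:
  assumes "\<phi> \<in> carrier (dual R M)"
  shows "\<exists>h\<in>H. \<phi> = functional h"
proof -
  have \<phi>: "\<phi> \<in> LinearCombinations.module_hom R M (ring_as_module R)" "\<phi> \<in> extensional (carrier M)"
    using assms unfolding carrier_dual by blast+
  obtain h where h: "h \<in> H" "\<forall>g\<in>G. N.pairing h g (\<rho> (\<phi> (seq_code g)))"
    using hom_represented[OF \<phi>(1)] by blast
  have "\<phi> = functional h"
  proof (rule extensionalityI[OF \<phi>(2)])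
    show "functional h \<in> extensional (carrier M)" unfolding functional_def by simp
    fix x assume "x \<in> carrier M"
    then obtain g where g: "g \<in> G" "x = seq_code g" by auto
    then have "pairing_val h g = \<rho> (\<phi> x)" using h(2) pairing_val_eq by blast
    moreover have "\<phi> x \<in> carrier R"
      using \<phi>(1) \<open>x \<in> carrier M\<close> by (auto simp: LinearCombinations.module_hom_def)
    ultimately show "\<phi> x = functional h x" using g by simp
  qed
  then show ?thesis using h(1) by blast
qed

lemma functional_add:
  assumes "h \<in> H" "k \<in> H"
  shows "functional (\<lambda>i. code_plus (h i) (k i)) = functional h \<oplus>\<^bsub>dual R M\<^esub> functional k"
proof -
  have "functional (\<lambda>i. code_plus (h i) (k i)) (seq_code g) =
      functional h (seq_code g) \<oplus> functional k (seq_code g)" if "g \<in> G" for g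
    using pairing_val_eq[OF N.pairing_add[OF pairing_val[OF that assms(1)] pairing_val[OF that assms(2)]]]
      that by simp
  then show ?thesis unfolding dual_ops
    by (intro extensionalityI[of _ "carrier M"]) (auto simp: functional_def)
qed

lemma functional_scale:
  assumes "h \<in> H"
  shows "functional (\<lambda>i. code_times r (h i)) = \<pi> r \<odot>\<^bsub>dual R M\<^esub> functional h"
proof -
  have "functional (\<lambda>i. code_times r (h i)) (seq_code g) = \<pi> r \<otimes> functional h (seq_code g)"
    if "g \<in> G" for g
    using pairing_val_eq[OF N.pairing_scale[OF pairing_val[OF that assms]]] that by simp
  then show ?thesis unfolding dual_ops
    by (intro extensionalityI[of _ "carrier M"]) (auto simp: functional_def)
qed

lemma evaluation_apply:
  assumes "x \<in> G" "h \<in> H"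
  shows "evaluation R M (seq_code x) (functional h) = \<pi> (pairing_val h x)"
  unfolding evaluation_def using assms functional_dual by simp

text \<open>The unit vectors lie in \<open>H\<close>, and evaluation at their functionals recovers
  all coordinates.\<close>

lemma evaluation_inj: "inj_on (evaluation R M) (carrier M)"
proof (rule inj_onI)
  fix x y assume "x \<in> carrier M" "y \<in> carrier M" and eq: "evaluation R M x = evaluation R M y"
  then obtain f g where fg: "f \<in> G" "g \<in> G" "x = seq_code f" "y = seq_code g" by auto
  have "f k = g k" for k
  proof -
    have "\<pi> (pairing_val (N.unit_seq k) f) = \<pi> (pairing_val (N.unit_seq k) g)"
      using eq evaluation_apply[OF fg(1) units_GH(2)] evaluation_apply[OF fg(2) units_GH(2)]
      unfolding fg(3,4) by metis
    then show ?thesis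
      unfolding pairing_val_eq[OF N.pairing_unit_left] by (simp only: code_eq_iff)
  qed
  then show "x = y" unfolding fg by presburger
qed

text \<open>Composed with \<open>functional\<close>, \<open>\<psi>\<close> becomes a linear
  functional on \<open>H\<close>. With the two sides exchanged it is represented by some
  \<open>g\<close> in \<open>G\<close>, and symmetry of the pairing makes \<open>g\<close> the
  preimage.\<close>

lemma evaluation_surj:
  assumes "\<psi> \<in> carrier (dual R (dual R M))"
  shows "\<exists>x\<in>carrier M. evaluation R M x = \<psi>"
proof -
  have \<psi>: "\<psi> \<in> LinearCombinations.module_hom R (dual R M) (ring_as_module R)"
    "\<psi> \<in> extensional (carrier (dual R M))"
    using assms unfolding carrier_dual[of _ R "dual R M"] by blast+
  have c: "\<psi> (functional h) \<in> carrier R" if "h \<in> H" for h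
    using LinearCombinations.module_hom_closed[OF \<psi>(1)] functional_dual[OF that] by auto
  have a: "\<psi> (functional (\<lambda>i. code_plus (h i) (k i))) = \<psi> (functional h) \<oplus> \<psi> (functional k)"
    if "h \<in> H" "k \<in> H" for h k
    unfolding functional_add[OF that]
    using LinearCombinations.module_hom_add[OF \<psi>(1) functional_dual functional_dual] that by simp
  have s: "\<psi> (functional (\<lambda>i. code_times r (h i))) = \<pi> r \<otimes> \<psi> (functional h)"
    if "h \<in> H" for h r
    unfolding functional_scale[OF that]
    using LinearCombinations.module_hom_smult[OF \<psi>(1) _ functional_dual] that by simp
  have "N.linear_on H (\<lambda>h. \<rho> (\<psi> (functional h)))"
    unfolding N.linear_on_def using c by (simp add: a s \<rho>_ops)
  from N.functional_represented[OF N.dual_pair_swap[OF GH] cov(2) this]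
  obtain g where g: "g \<in> G" "\<forall>h\<in>H. N.pairing g h (\<rho> (\<psi> (functional h)))" by blast
  have "evaluation R M (seq_code g) = \<psi>"
  proof (rule extensionalityI[OF _ \<psi>(2)])
    show "evaluation R M (seq_code g) \<in> extensional (carrier (dual R M))"
      unfolding evaluation_def using g(1) by simp
    fix \<phi> assume "\<phi> \<in> carrier (dual R M)"
    then obtain h where h: "h \<in> H" "\<phi> = functional h" using dual_functional by blast
    have "N.pairing g h (\<rho> (\<psi> \<phi>))" using g(2) h by blast
    then have "pairing_val h g = \<rho> (\<psi> \<phi>)"
      by (intro pairing_val_eq) (rule N.pairing_commute[THEN iffD1])
    then show "evaluation R M (seq_code g) \<phi> = \<psi> \<phi>"
      using evaluation_apply[OF g(1) h(1)] c[OF h(1)] unfolding h(2) by simp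
  qed
  then show ?thesis using g(1) by auto
qed

lemma reflexive_M: "reflexive_module R M"
proof -
  have "evaluation R M \<in> LinearCombinations.module_hom R M (dual R (dual R M))"
    using module_M by (rule evaluation_hom)
  moreover have "bij_betw (evaluation R M) (carrier M) (carrier (dual R (dual R M)))"
    unfolding bij_betw_def
  proof (intro conjI evaluation_inj subset_antisym subsetI)
    fix \<psi> assume "\<psi> \<in> evaluation R M ` carrier M"
    then show "\<psi> \<in> carrier (dual R (dual R M))"
      using calculation LinearCombinations.module_hom_closed by blast
  next
    fix \<psi> assume "\<psi> \<in> carrier (dual R (dual R M))"
    then show "\<psi> \<in> evaluation R M ` carrier M" using evaluation_surj by blast
  qed
  ultimately show ?thesis unfolding reflexive_module_def module_iso_def using module_M by blast
qed

section \<open>Excluding an isomorphism with the direct sum\<close>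

text \<open>From an isomorphism \<open>f\<close> onto the sum one gets \<open>\<phi>\<close>, the
  inverse of \<open>f\<close> on the summand \<open>M\<close>, and \<open>e\<close>, the preimage of
  the unit of the summand \<open>R\<close>. Then \<open>\<phi>\<close> is injective and its image
  meets the multiples of \<open>e\<close> only in zero, which \<open>no_complement\<close>
  excludes.\<close>

lemma not_isomorphic:
  "\<not> isomorphic_modules R M (SumSpaces.direct_sum (ring_as_module R) M)"
proof
  let ?S = "SumSpaces.direct_sum (ring_as_module R) M"
  assume "isomorphic_modules R M ?S"
  then obtain f where f: "f \<in> LinearCombinations.module_hom R M ?S"
    and bij: "bij_betw f (carrier M) (carrier ?S)"
    unfolding isomorphic_modules_def module_iso_def by blast
  have S: "carrier ?S = carrier R \<times> carrier M"
    "(a, x) \<oplus>\<^bsub>?S\<^esub> (b, y) = (a \<oplus> b, x \<oplus>\<^bsub>M\<^esub> y)" "r \<odot>\<^bsub>?S\<^esub> (a, x) = (r \<otimes> a, r \<odot>\<^bsub>M\<^esub> x)"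
    for a b r x y by (simp_all add: SumSpaces.direct_sum_def)
  have fadd: "f (seq_code (\<lambda>i. code_plus (x i) (y i))) = f (seq_code x) \<oplus>\<^bsub>?S\<^esub> f (seq_code y)"
    if "x \<in> G" "y \<in> G" for x y
    using LinearCombinations.module_hom_add[OF f, of "seq_code x" "seq_code y"] that by simp
  have fscale: "f (seq_code (\<lambda>i. code_times r (x i))) = \<pi> r \<odot>\<^bsub>?S\<^esub> f (seq_code x)"
    if "x \<in> G" for x r
    using LinearCombinations.module_hom_smult[OF f, of "\<pi> r" "seq_code x"] that by simp
  have finj: "x = y" if "x \<in> G" "y \<in> G" "f (seq_code x) = f (seq_code y)" for x y
  proof -
    have "seq_code x = seq_code y"
      using bij_betw_imp_inj_on[OF bij] that(3) by (rule inj_onD) (simp_all add: that)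
    then show ?thesis using inj_seq_code by (simp add: inj_eq)
  qed
  have surj: "\<exists>x. x \<in> G \<and> f (seq_code x) = s" if "s \<in> carrier R \<times> carrier M" for s
  proof -
    have "s \<in> f ` carrier M" using that bij_betw_imp_surj_on[OF bij] unfolding S(1) by (simp only:)
    then show ?thesis by auto
  qed
  define \<phi> where "\<phi> g = (SOME x. x \<in> G \<and> f (seq_code x) = (\<zero>, seq_code g))" for g
  have \<phi>: "\<phi> g \<in> G" "f (seq_code (\<phi> g)) = (\<zero>, seq_code g)" if "g \<in> G" for g
    using someI_ex[OF surj[of "(\<zero>, seq_code g)"]] that unfolding \<phi>_def by auto
  obtain e where e: "e \<in> G" "f (seq_code e) = (\<one>, seq_code (\<lambda>_. code_zero))"
    using surj[of "(\<one>, seq_code (\<lambda>_. code_zero))"] N.pure_zero[OF pure_GH(1)] by auto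
  show False
  proof (rule N.no_complement[OF p GH tr, where \<phi> = \<phi> and e = e])
    show "\<phi> x \<in> G" if "x \<in> G" for x using that by (rule \<phi>)
    show "\<phi> (\<lambda>i. code_plus (x i) (y i)) = (\<lambda>i. code_plus (\<phi> x i) (\<phi> y i))"
      if "x \<in> G" "y \<in> G" for x y
    proof (rule finj)
      show "\<phi> (\<lambda>i. code_plus (x i) (y i)) \<in> G" using that pure_GH(1) by (intro \<phi>(1) N.pure_add)
      show "(\<lambda>i. code_plus (\<phi> x i) (\<phi> y i)) \<in> G" using that pure_GH(1) by (intro \<phi>(1) N.pure_add)
      show "f (seq_code (\<phi> (\<lambda>i. code_plus (x i) (y i)))) =
          f (seq_code (\<lambda>i. code_plus (\<phi> x i) (\<phi> y i)))"
        unfolding fadd[OF \<phi>(1)[OF that(1)] \<phi>(1)[OF that(2)]] \<phi>(2)[OF that(1)] \<phi>(2)[OF that(2)]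
          \<phi>(2)[OF N.pure_add[OF pure_GH(1) that]] S(2) by simp
    qed
    show "\<phi> (\<lambda>i. code_times r (x i)) = (\<lambda>i. code_times r (\<phi> x i))" if "x \<in> G" for r x
    proof (rule finj)
      show "\<phi> (\<lambda>i. code_times r (x i)) \<in> G" using that pure_GH(1) by (intro \<phi>(1) N.pure_scale)
      show "(\<lambda>i. code_times r (\<phi> x i)) \<in> G" using that pure_GH(1) by (intro \<phi>(1) N.pure_scale)
      show "f (seq_code (\<phi> (\<lambda>i. code_times r (x i)))) = f (seq_code (\<lambda>i. code_times r (\<phi> x i)))"
        unfolding fscale[OF \<phi>(1)[OF that]] \<phi>(2)[OF that]
          \<phi>(2)[OF N.pure_scale[OF pure_GH(1) that]] S(3) by simp
    qed
    show "inj_on \<phi> G"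
    proof (rule inj_onI)
      fix x y assume "x \<in> G" "y \<in> G" "\<phi> x = \<phi> y"
      then have "seq_code x = seq_code y" using \<phi>(2)[of x] \<phi>(2)[of y] by simp
      then show "x = y" using inj_seq_code by (simp add: inj_eq)
    qed
    show "e \<in> G" by (rule e(1))
    fix a w assume w: "w \<in> G" "\<phi> w = (\<lambda>i. code_times a (e i))"
    \<comment> \<open>Both sides are the image under \<open>f\<close> of
      \<open>\<phi> w = a e\<close>; comparing first components gives \<open>a = 0\<close>.\<close>
    have "(\<zero>, seq_code w) = \<pi> a \<odot>\<^bsub>?S\<^esub> (\<one>, seq_code (\<lambda>_. code_zero))"
      using \<phi>(2)[OF w(1)] unfolding w(2) fscale[OF e(1)] e(2) by simp
    then have "\<zero> = \<pi> a" unfolding S(3) by simp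
    then show "a = code_zero" by (simp add: code_eq_iff)
  qed
qed

end

section \<open>Assembling the module of cardinality aleph_1\<close>

text \<open>In a finite domain multiplication by a nonzero element is injective, hence surjective.
  An infinite carrier is needed for the bijection with all natural numbers.\<close>

lemma (in domain) infinite_carrier_of_not_field:
  assumes "\<not> Ring.field R"
  shows "infinite (carrier R)"
proof
  assume fin: "finite (carrier R)"
  have "Units R = carrier R - {\<zero>}"
  proof
    show "Units R \<subseteq> carrier R - {\<zero>}"
    proof
      fix x assume "x \<in> Units R"
      then show "x \<in> carrier R - {\<zero>}" using zero_not_one unfolding Units_def by auto
    qed
    show "carrier R - {\<zero>} \<subseteq> Units R"
    proof
      fix a assume a: "a \<in> carrier R - {\<zero>}"
      have "inj_on (\<lambda>x. a \<otimes> x) (carrier R)" using a by (intro inj_onI) (simp add: m_lcancel)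
      moreover have "(\<lambda>x. a \<otimes> x) ` carrier R \<subseteq> carrier R" using a by auto
      ultimately have "(\<lambda>x. a \<otimes> x) ` carrier R = carrier R" using fin by (simp add: endo_inj_surj)
      then have "\<one> \<in> (\<lambda>x. a \<otimes> x) ` carrier R" by simp
      then obtain x where x: "x \<in> carrier R" "a \<otimes> x = \<one>" by (metis imageE)
      then have "x \<otimes> a = \<one>" using a m_comm[of x a] by simp
      then show "a \<in> Units R" using a x unfolding Units_def by blast
    qed
  qed
  then have "Ring.field R" by (rule cring_fieldI)
  with assms show False by blast
qed

theorem theorem1p2:
  fixes R :: "('a, 'r) ring_scheme"
  assumes "diamond aleph_1"
    and "principal_domain R"
    and "Countable_Set.countable (carrier R)"
    and "\<not> Ring.field R"
  shows "\<exists>G :: ('a, nat set) module.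
           reflexive_module R G \<and>
           |carrier G| =o aleph_1 \<and>
           \<not> isomorphic_modules R G (SumSpaces.direct_sum (ring_as_module R) G)"
proof -
  interpret principal_domain R by (rule assms(2))
  have inf: "infinite (carrier R)" using assms(4) by (rule infinite_carrier_of_not_field)
  define \<pi> \<rho> where "\<pi> = from_nat_into (carrier R)" and "\<rho> = to_nat_on (carrier R)"
  interpret C: coded_domain R \<pi> \<rho>
  proof unfold_locales
    show "\<pi> n \<in> carrier R" for n unfolding \<pi>_def using inf by (intro from_nat_into) auto
    show "\<rho> (\<pi> n) = n" for n
      unfolding \<pi>_def \<rho>_def using assms(3) inf by (rule to_nat_on_from_nat_into_infinite)
    show "\<pi> (\<rho> a) = a" if "a \<in> carrier R" for a
      unfolding \<pi>_def \<rho>_def using assms(3) that by (rule from_nat_into_to_nat_on)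
  qed
  \<comment> \<open>This yields a nonzero nonunit, whose code is the \<open>p\<close> of the
    construction.\<close>
  have "Units R \<noteq> carrier R - {\<zero>\<^bsub>R\<^esub>}" using assms(4) cring_fieldI by blast
  moreover have "Units R \<subseteq> carrier R - {\<zero>\<^bsub>R\<^esub>}"
    using zero_not_one unfolding Units_def by auto
  ultimately obtain a where a: "a \<in> carrier R" "a \<noteq> \<zero>\<^bsub>R\<^esub>" "a \<notin> Units R" by blast
  have p: "\<rho> a \<noteq> C.code_zero" "\<not> dvd.dvd C.code_times (\<rho> a) C.code_one"
  proof -
    show "\<rho> a \<noteq> C.code_zero" using a by (simp add: C.code_eq_iff)
    show "\<not> dvd.dvd C.code_times (\<rho> a) C.code_one"
    proof
      assume "dvd.dvd C.code_times (\<rho> a) C.code_one"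
      then obtain k where "C.code_one = C.code_times (\<rho> a) k" unfolding dvd.dvd_def by blast
      then have k: "a \<otimes>\<^bsub>R\<^esub> \<pi> k = \<one>\<^bsub>R\<^esub>" using a(1) by (simp add: C.code_eq_iff)
      then have "\<pi> k \<otimes>\<^bsub>R\<^esub> a = \<one>\<^bsub>R\<^esub>" using a(1) m_comm[of "\<pi> k" a] by simp
      then have "a \<in> Units R" using a(1) k C.\<pi>_closed[of k] unfolding Units_def by blast
      with a(3) show False by blast
    qed
  qed
  have CH: "|UNIV :: nat set set| \<le>o aleph_1" using assms(1) by (rule diamond_imp_CH)
  have aleph: "|Field aleph_1| =o aleph_1" by (rule card_of_Field_ordIso[OF Card_order_aleph_1])
  \<comment> \<open>A matrix is flattened along \<open>prod_decode\<close> and coded as a set of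
    numbers, so CH bounds the number of matrices by aleph_1.\<close>
  have "inj (\<lambda>A :: nat \<Rightarrow> nat \<Rightarrow> nat. seq_code (\<lambda>n. case_prod A (prod_decode n)))"
  proof (rule injI)
    fix A B :: "nat \<Rightarrow> nat \<Rightarrow> nat"
    assume "seq_code (\<lambda>n. case_prod A (prod_decode n)) = seq_code (\<lambda>n. case_prod B (prod_decode n))"
    then have "(\<lambda>n. case_prod A (prod_decode n)) = (\<lambda>n. case_prod B (prod_decode n))"
      by (rule injD[OF inj_seq_code])
    then have "case_prod A (prod_decode (prod_encode (i, j))) = case_prod B (prod_decode (prod_encode (i, j)))"
      for i j by (rule fun_cong)
    then show "A = B" by (intro ext) simp
  qed
  then have "|UNIV :: (nat \<Rightarrow> nat \<Rightarrow> nat) set| \<le>o |UNIV :: nat set set|"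
    unfolding card_of_ordLeq[symmetric] by blast
  then have "|UNIV :: (nat \<Rightarrow> nat \<Rightarrow> nat) set| \<le>o |Field aleph_1|"
    using ordLeq_transitive[OF _ CH] ordLeq_ordIso_trans ordIso_symmetric[OF aleph] by blast
  then obtain \<iota> :: "(nat \<Rightarrow> nat \<Rightarrow> nat) \<Rightarrow> nat set" where \<iota>: "inj \<iota>" "range \<iota> \<subseteq> Field aleph_1"
    unfolding card_of_ordLeq[symmetric] by blast
  \<comment> \<open>The left inverse of \<open>\<iota>\<close> takes the value \<open>A\<close> at
    the index \<open>\<iota> A\<close>, so every matrix is listed.\<close>
  define c where "c = inv_into UNIV \<iota>"
  have "\<exists>G H. C.N.dual_pair G H \<and> \<not> countable G \<and> (\<forall>f. C.N.covered f G H) \<and>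
    (\<forall>f. C.N.covered f H G) \<and> (\<forall>A. C.N.treated A G H)"
  proof (rule C.N.exists_reflexive_pair[OF p, where r = aleph_1 and c = c])
    show "countable (UNIV :: nat set)" by simp
    show "Well_order aleph_1" using Card_order_aleph_1 by (simp add: card_order_on_def)
    show "countable (underS aleph_1 i)" if "i \<in> Field aleph_1" for i
      unfolding countable_ordLess_aleph_1 using Card_order_aleph_1 that by (rule card_of_underS)
    show "\<not> countable (Field aleph_1)"
      unfolding countable_ordLeq_aleph_1 by (rule ordIso_imp_ordLeq[OF ordIso_symmetric[OF aleph]])
    show "\<exists>i\<in>Field aleph_1. c i = A" for A
      using \<iota> unfolding c_def by (intro bexI[of _ "\<iota> A"]) auto
  qed
  then obtain G H where GH: "C.N.dual_pair G H" "\<not> countable G" "\<And>f. C.N.covered f G H"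
    "\<And>f. C.N.covered f H G" "\<And>A. C.N.treated A G H" by blast
  interpret P: coded_pair R \<pi> \<rho> "\<rho> a" G H
    by unfold_locales (fact p GH)+
  \<comment> \<open>CH gives the upper bound, as all elements are sets of numbers; uncountability of
    \<open>G\<close> gives the lower one.\<close>
  have "|seq_code ` G| =o aleph_1"
  proof (rule ordIso_iff_ordLeq[THEN iffD2], rule conjI)
    have "|seq_code ` G| \<le>o |UNIV :: nat set set|" by (rule card_of_mono1) simp
    then show "|seq_code ` G| \<le>o aleph_1" using CH by (rule ordLeq_transitive)
    have "\<not> countable (seq_code ` G)"
      using GH(2) countable_image_inj_on[OF _ inj_on_subset[OF inj_seq_code subset_UNIV]] by blast
    then show "aleph_1 \<le>o |seq_code ` G|" unfolding countable_ordLeq_aleph_1 .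
  qed
  then show ?thesis
    using P.reflexive_M P.not_isomorphic by (intro exI[of _ "C.coded_module G"]) simp
qed

end
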